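(* Let $n=1$, $m\in(0,1)$, $\kappa\geq1$, $\theta>0$, and $\gamma(x,t)=x-\theta t^\kappa$. Then, for every $s>\frac12-\frac m4$ and every $f\in H^s(\mathbb R)$, \[ \lim_{\substack{(y,t)\to(x,0)\\ y=\gamma(x,t)}}e^{it(-\Delta)^{m/2}}f(y)=f(x)\quad\text{for almost every }x\in\mathbb R . \] Furthermore, whenever $s\in\left(\frac12-\frac m4,\frac12\right)$, for every $f\in H^s(\mathbb R)$, \[ \dim_H\mathfrak D(f\circ\gamma)\leq\frac{1-2s}{m}. \]
   Context: $\dim_H$ denotes Hausdorff dimension. $H^s(\mathbb R)$ is the inhomogeneous $L^2$-Sobolev space with norm $\|f\|_{H^s(\mathbb R)}=\|(1-\Delta)^{s/2}f\|_{L^2(\mathbb R)}$. With $\widehat f(\xi)=\int_{\mathbb R}e^{-ix\xi}f(x)\,dx$, one (formally) sets \[ e^{it(-\Delta)^{m/2}}f(x)=(2\pi)^{-1}\int_{\mathbb R}e^{i(x\xi+t|\xi|^m)}\widehat f(\xi)\,d\xi . \] For $f\in H^s(\mathbb R)$ the value at a given point $x$ and time $t$ is understood as $\lim_{N\to\infty}(2\pi)^{-1}\int_{\mathbb R}e^{i(x\xi+t|\xi|^m)}e^{-|\xi|^2/N^2}\widehat f(\xi)\,d\xi$ whenever this limit exists, and $f(x)$ denotes the value so obtained at $t=0$. The limit along $\gamma$ is the limit of $e^{it(-\Delta)^{m/2}}f(x-\theta t^\kappa)$ as $t\to0$ with $t>0$. $\mathfrak D(f\circ\gamma)$ denotes the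 divergence set along $\gamma$, i.e. the set of $x\in\mathbb R$ at which the convergence $e^{it(-\Delta)^{m/2}}f(\gamma(x,t))\to f(x)$ as $t\to0$ fails (points where $f(x)$, or the values for all sufficiently small $t>0$, are not defined are counted as belonging to it). *)

theory Defs
  imports "HOL-Analysis.Analysis"
begin

section \<open>Fourier transform and Sobolev spaces on the real line\<close>

text \<open>Complex-valued functions with square-integrable modulus. Functions are not identified up
  to null sets; everything below depends only on the almost-everywhere class.\<close>

definition L2_functions :: "(real \<Rightarrow> complex) set" where
  "L2_functions = {f. f \<in> borel_measurable lebesgue \<and> integrable lebesgue (\<lambda>x. (cmod (f x))\<^sup>2)}"

text \<open>The Fourier transform of a square-integrable function is the \<open>L\<^sup>2\<close>-limit of the transforms
  of its truncations. The distance is a nonnegative integral, because the Bochner integral of a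
  non-integrable function would be \<open>0\<close>.\<close>

definition fourier_truncated :: "(real \<Rightarrow> complex) \<Rightarrow> real \<Rightarrow> real \<Rightarrow> complex" where
  "fourier_truncated f R \<xi> = (LINT x:{-R..R}|lebesgue. cis (- (x * \<xi>)) * f x)"

definition is_fourier_transform :: "(real \<Rightarrow> complex) \<Rightarrow> (real \<Rightarrow> complex) \<Rightarrow> bool" where
  "is_fourier_transform f g \<longleftrightarrow>
     g \<in> L2_functions \<and>
     ((\<lambda>R. \<integral>\<^sup>+ \<xi>. ennreal ((cmod (g \<xi> - fourier_truncated f R \<xi>))\<^sup>2) \<partial>lebesgue) \<longlongrightarrow> 0) at_top"

text \<open>For \<open>f \<in> L2_functions\<close> such a \<open>g\<close> exists by Plancherel's theorem and is unique up to null
  sets, so the choice of representative is immaterial.\<close>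

definition fourier :: "(real \<Rightarrow> complex) \<Rightarrow> real \<Rightarrow> complex" where
  "fourier f = (SOME g. is_fourier_transform f g)"

text \<open>The inhomogeneous Sobolev space \<open>H\<^sup>s\<close> for \<open>s \<ge> 0\<close>, where it is a space of functions in
  \<open>L\<^sup>2\<close>; the weight is the symbol of \<open>(1 - \<Delta>)\<close> to the power \<open>s / 2\<close>. For \<open>s < 0\<close> the definition
  would miss the elements of \<open>H\<^sup>s\<close> that are not in \<open>L\<^sup>2\<close>.\<close>

definition sobolev :: "real \<Rightarrow> (real \<Rightarrow> complex) set" where
  "sobolev s = {f \<in> L2_functions.
     (\<lambda>\<xi>. complex_of_real ((1 + \<xi>\<^sup>2) powr (s / 2)) * fourier f \<xi>) \<in> L2_functions}"


section \<open>The propagator and its divergence set along a curve\<close>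

definition regularized :: "real \<Rightarrow> (real \<Rightarrow> complex) \<Rightarrow> real \<Rightarrow> real \<Rightarrow> real \<Rightarrow> complex" where
  "regularized m f N t x =
     complex_of_real (1 / (2 * pi)) *
     (LINT \<xi>|lebesgue. cis (x * \<xi> + t * \<bar>\<xi>\<bar> powr m) * complex_of_real (exp (- (\<bar>\<xi>\<bar>\<^sup>2 / N\<^sup>2))) * fourier f \<xi>)"

definition has_value :: "real \<Rightarrow> (real \<Rightarrow> complex) \<Rightarrow> real \<Rightarrow> real \<Rightarrow> bool" where
  "has_value m f t x \<longleftrightarrow> (\<exists>v. ((\<lambda>N. regularized m f N t x) \<longlongrightarrow> v) at_top)"

text \<open>Meaningful only where \<open>has_value m f t x\<close> holds. At \<open>t = 0\<close> this is the value of \<open>f\<close> itself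
  at \<open>x\<close>, independently of \<open>m\<close> and of the representative \<open>f\<close>.\<close>

definition propagator :: "real \<Rightarrow> (real \<Rightarrow> complex) \<Rightarrow> real \<Rightarrow> real \<Rightarrow> complex" where
  "propagator m f t x = Lim at_top (\<lambda>N. regularized m f N t x)"

definition converges_along ::
  "real \<Rightarrow> (real \<Rightarrow> complex) \<Rightarrow> (real \<Rightarrow> real \<Rightarrow> real) \<Rightarrow> real \<Rightarrow> bool" where
  "converges_along m f \<gamma> x \<longleftrightarrow>
     has_value m f 0 x \<and>
     (\<forall>\<^sub>F t in at_right 0. has_value m f t (\<gamma> x t)) \<and>
     ((\<lambda>t. propagator m f t (\<gamma> x t)) \<longlongrightarrow> propagator m f 0 x) (at_right 0)"

definition divergence_set ::
  "real \<Rightarrow> (real \<Rightarrow> complex) \<Rightarrow> (real \<Rightarrow> real \<Rightarrow> real) \<Rightarrow> real set" where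
  "divergence_set m f \<gamma> = {x. \<not> converges_along m f \<gamma> x}"


section \<open>Hausdorff measures and dimension\<close>

text \<open>The usual convention that \<open>0\<close> to the power \<open>0\<close> is \<open>1\<close> for nonempty sets and that the empty
  set has size \<open>0\<close>; note that \<open>0 powr 0 = 0\<close>.\<close>

definition diam_power :: "real \<Rightarrow> 'a::metric_space set \<Rightarrow> ennreal" where
  "diam_power d U = (if U = {} then 0 else if d = 0 then 1 else ennreal (diameter U powr d))"

text \<open>Boundedness is required explicitly because \<open>diameter\<close> carries no information on unbounded
  sets.\<close>

definition hausdorff_premeasure :: "real \<Rightarrow> real \<Rightarrow> 'a::metric_space set \<Rightarrow> ennreal" where
  "hausdorff_premeasure d \<delta> A =
     (INF U \<in> {U :: nat \<Rightarrow> 'a set. (\<forall>i. bounded (U i) \<and> diameter (U i) \<le> \<delta>) \<and> A \<subseteq> (\<Union>i. U i)}.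
        \<Sum>i. diam_power d (U i))"

definition hausdorff_measure :: "real \<Rightarrow> 'a::metric_space set \<Rightarrow> ennreal" where
  "hausdorff_measure d A = (SUP \<delta> \<in> {0<..}. hausdorff_premeasure d \<delta> A)"

definition hausdorff_dim :: "'a::metric_space set \<Rightarrow> ennreal" where
  "hausdorff_dim A = Inf {ennreal d | d. d \<ge> 0 \<and> hausdorff_measure d A = 0}"

end

theory Submission
  imports Defs "HOL-Probability.Distributions"
begin

text \<open>Only the Fourier side \<open>g\<close> of \<open>f\<close> matters. At frequencies of size \<open>\<Lambda>\<close>, van der Corput's
  lemma bounds the kernel of \<open>T T\<^sup>*\<close> between two points \<open>x\<close>, \<open>y\<close> by
  \<open>\<Lambda> (1 + \<Lambda>\<^sup>m \<bar>x - y\<bar>)\<^sup>-\<^sup>1\<^sup>/\<^sup>2\<close>, whatever the times: if \<open>\<bar>t - t'\<bar>\<close> is small compared with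
  \<open>\<bar>x - y\<bar>\<close> the phase is not stationary, because the curve is Lipschitz in time, and otherwise the second
  derivative of the phase has size \<open>\<bar>t - t'\<bar> \<Lambda>\<^sup>m\<^sup>-\<^sup>2\<close>. Testing against a discrete Frostman weight
  of dimension \<open>\<alpha> < 1/2\<close> at scale \<open>\<Lambda>\<^sup>-\<^sup>m\<close> covers the set where the frequency piece exceeds \<open>\<eta>\<close> for some
  time by intervals \<open>U\<close> with \<open>\<Sum> diam(U)\<^sup>\<alpha>\<close> bounded by \<open>\<Lambda>\<^sup>1\<^sup>-\<^sup>m\<^sup>\<alpha> \<eta>\<^sup>-\<^sup>2\<close> times the squared
  \<open>L\<^sup>2\<close> norm of the piece, which is at most a constant times \<open>\<Lambda>\<^sup>-\<^sup>2\<^sup>s\<close>.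
  For \<open>\<alpha> > (1 - 2 s) / m\<close> this is summable over dyadic \<open>\<Lambda>\<close> with room for \<open>\<eta> = \<Lambda>\<^sup>-\<^sup>\<epsilon>\<close>, so outside a
  limsup set of vanishing \<open>\<alpha>\<close>-dimensional measure the dyadic series converges uniformly
  in time. The Gaussian regularisation only adds a decreasing amplitude to the oscillatory integrals, with
  bounds uniform in its parameter.\<close>

section \<open>Oscillatory integrals\<close>

text \<open>Here \<open>q\<close> is a regular substitute for \<open>1/\<phi>'\<close>; the last hypothesis on it controls the derivative
  of the difference between the integral and \<open>- \<i> cis \<phi> a q\<close>.\<close>

lemma oscillatory_integral_bound:
  fixes \<phi> \<phi>' a a' q q' G G' :: "real \<Rightarrow> real"
  assumes "lo \<le> hi"
    and \<phi>: "\<And>x. x \<in> {lo..hi} \<Longrightarrow> (\<phi> has_real_derivative \<phi>' x) (at x)"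
    and a: "\<And>x. x \<in> {lo..hi} \<Longrightarrow> (a has_real_derivative a' x) (at x)"
    and q: "\<And>x. x \<in> {lo..hi} \<Longrightarrow> (q has_real_derivative q' x) (at x)"
    and G: "\<And>x. x \<in> {lo..hi} \<Longrightarrow> (G has_real_derivative G' x) (at x)"
    and a_le: "\<And>x. x \<in> {lo..hi} \<Longrightarrow> 0 \<le> a x \<and> a x \<le> 1"
    and a'_le: "\<And>x. x \<in> {lo..hi} \<Longrightarrow> a' x \<le> 0"
    and q_le: "\<And>x. x \<in> {lo..hi} \<Longrightarrow> \<bar>q x\<bar> \<le> B"
    and G'_ge: "\<And>x. x \<in> {lo..hi} \<Longrightarrow> \<bar>1 - \<phi>' x * q x\<bar> + \<bar>q' x\<bar> \<le> G' x"
    and V: "G hi - G lo \<le> V"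
  shows "cmod (integral {lo..hi} (\<lambda>x. cis (\<phi> x) * complex_of_real (a x))) \<le> 3 * B + V"
proof (cases "lo = hi")
  case True
  then have "0 \<le> B" "0 \<le> V" using q_le[of lo] V by auto
  with True show ?thesis by simp
next
  case False
  with \<open>lo \<le> hi\<close> have lh: "lo < hi" by simp
  let ?f = "\<lambda>x. cis (\<phi> x) * complex_of_real (a x)"
  \<comment> \<open>\<open>- b\<close> is the boundary term of an integration by parts in which
    \<open>q\<close> stands in for \<open>1 / \<phi>'\<close>. Adding \<open>b\<close> to the
    integral leaves in \<open>F'\<close> only the defect \<open>1 - \<phi>' x * q x\<close> and
    terms with the derivatives of \<open>a\<close> and \<open>q\<close>.\<close>
  define b where "b x = \<i> * cis (\<phi> x) * complex_of_real (a x * q x)" for x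
  define F where "F x = integral {lo..x} ?f + b x" for x
  define F' where "F' x = cis (\<phi> x) *
      (complex_of_real (a x * (1 - \<phi>' x * q x)) + \<i> * complex_of_real (a' x * q x + a x * q' x))" for x
  have cis_der: "((\<lambda>x. cis (\<phi> x)) has_vector_derivative \<i> * complex_of_real (\<phi>' x) * cis (\<phi> x)) (at x)"
    if "x \<in> {lo..hi}" for x
  proof -
    from has_derivative_cis[OF \<phi>[OF that, unfolded has_field_derivative_def]]
    have "((\<lambda>x. cis (\<phi> x)) has_vector_derivative \<phi>' x *\<^sub>R (\<i> * cis (\<phi> x))) (at x)"
      by (simp add: has_vector_derivative_def mult_ac)
    then show ?thesis by (simp add: scaleR_conv_of_real mult_ac)
  qed
  have of_real_der: "((\<lambda>x. complex_of_real (h x)) has_vector_derivative complex_of_real h') (at x)"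
    if "(h has_real_derivative h') (at x)" for h h' x
    by (rule has_vector_derivative_of_real[OF that])
  have f_cont: "continuous_on {lo..hi} ?f"
    by (intro continuous_at_imp_continuous_on ballI continuous_mult)
      (use cis_der of_real_der a has_vector_derivative_continuous in blast)+
  have b_der: "(b has_vector_derivative F' x - ?f x) (at x)" if x: "x \<in> {lo..hi}" for x
  proof -
    have "((\<lambda>x. \<i> * cis (\<phi> x) * complex_of_real (a x * q x)) has_vector_derivative
        (\<i> * cis (\<phi> x)) * complex_of_real (a' x * q x + a x * q' x)
        + (\<i> * (\<i> * complex_of_real (\<phi>' x) * cis (\<phi> x))) * complex_of_real (a x * q x)) (at x)"
      by (intro has_vector_derivative_mult has_vector_derivative_mult_right cis_der[OF x]
          of_real_der)
        (use a[OF x] q[OF x] in \<open>auto intro!: derivative_eq_intros\<close>)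
    moreover have "(\<i> * cis (\<phi> x)) * complex_of_real (a' x * q x + a x * q' x)
        + (\<i> * (\<i> * complex_of_real (\<phi>' x) * cis (\<phi> x))) * complex_of_real (a x * q x) = F' x - ?f x"
      by (simp add: F'_def algebra_simps flip: power2_eq_square)
    ultimately show ?thesis unfolding b_def by simp
  qed
  have F_der: "(F has_vector_derivative F' x) (at x)" if x: "lo < x" "x < hi" for x
  proof -
    have "((\<lambda>u. integral {lo..u} ?f) has_vector_derivative ?f x) (at x within {lo..hi})"
      by (rule integral_has_vector_derivative[OF f_cont]) (use x in auto)
    then have "((\<lambda>u. integral {lo..u} ?f) has_vector_derivative ?f x) (at x)"
      using x by (simp add: at_within_Icc_at)
    from has_vector_derivative_add[OF this b_der[of x]] x show ?thesis
      unfolding F_def by simp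
  qed
  have b_cont: "continuous_on {lo..hi} b"
    by (intro continuous_at_imp_continuous_on ballI has_vector_derivative_continuous[OF b_der])
  have F_cont: "continuous_on {lo..hi} F"
    unfolding F_def
    by (intro continuous_on_add indefinite_integral_continuous_1 integrable_continuous_real f_cont b_cont)
  \<comment> \<open>As \<open>a\<close> decreases, \<open>\<bar>a' x * q x\<bar>\<close> is at most
    \<open>- B * a' x\<close>, so the amplitude costs only its total variation, and the increments
    of \<open>G - B * a\<close> bound those of \<open>F\<close>.\<close>
  have F'_le: "cmod (F' x) \<le> G' x - B * a' x" if x: "x \<in> {lo..hi}" for x
  proof -
    have "cmod (F' x) \<le> \<bar>a x * (1 - \<phi>' x * q x)\<bar> + \<bar>a' x * q x + a x * q' x\<bar>"
      unfolding F'_def norm_mult norm_cis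
      by (rule order_trans[OF mult_left_mono[OF norm_triangle_ineq]])
         (simp_all add: norm_mult del: of_real_add of_real_mult of_real_diff)
    also have "\<dots> \<le> a x * (\<bar>1 - \<phi>' x * q x\<bar> + \<bar>q' x\<bar>) + (- a' x) * \<bar>q x\<bar>"
    proof -
      have "\<bar>a x * (1 - \<phi>' x * q x)\<bar> = a x * \<bar>1 - \<phi>' x * q x\<bar>" "\<bar>a x * q' x\<bar> = a x * \<bar>q' x\<bar>"
        "\<bar>a' x * q x\<bar> = - a' x * \<bar>q x\<bar>"
        using a_le[OF x] a'_le[OF x] by (simp_all add: abs_mult)
      then show ?thesis
        using abs_triangle_ineq[of "a' x * q x" "a x * q' x"] by (simp add: distrib_left)
    qed
    also have "\<dots> \<le> 1 * (\<bar>1 - \<phi>' x * q x\<bar> + \<bar>q' x\<bar>) + (- a' x) * B"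
      using a_le[OF x] a'_le[OF x] q_le[OF x] by (intro add_mono mult_mono) auto
    also have "\<dots> \<le> G' x - B * a' x" using G'_ge[OF x] by (simp add: mult.commute)
    finally show ?thesis .
  qed
  have Ga_der: "((\<lambda>x. G x - B * a x) has_real_derivative G' x - B * a' x) (at x)"
    if "x \<in> {lo..hi}" for x
    using G[OF that] a[OF that] by (auto intro!: derivative_eq_intros)
  have "cmod (F hi - F lo) \<le> (G hi - B * a hi) - (G lo - B * a lo)"
  proof (rule differentiable_bound_general[OF lh F_cont _ F_der])
    show "continuous_on {lo..hi} (\<lambda>x. G x - B * a x)"
      using Ga_der DERIV_continuous by (blast intro: continuous_at_imp_continuous_on)
    show "((\<lambda>x. G x - B * a x) has_vector_derivative G' x - B * a' x) (at x)"
      if "lo < x" "x < hi" for x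
      using Ga_der[of x] that by (simp add: has_real_derivative_iff_has_vector_derivative)
    show "cmod (F' x) \<le> G' x - B * a' x" if "lo < x" "x < hi" for x
      using F'_le[of x] that by simp
  qed
  moreover have "integral {lo..hi} ?f = (F hi - F lo) - b hi + b lo"
    by (simp add: F_def)
  moreover have "cmod (b x) \<le> B * a x" if "x \<in> {lo..hi}" for x
    using a_le[OF that] q_le[OF that]
    by (simp add: b_def norm_mult abs_mult mult.commute[of "a x"] mult_right_mono del: of_real_mult)
  moreover have "cmod ((F hi - F lo) - b hi + b lo) \<le> cmod (F hi - F lo) + cmod (b hi) + cmod (b lo)"
    by (intro norm_triangle_le add_mono norm_triangle_ineq4 order_refl)
  \<comment> \<open>The comparison contributes \<open>B * a lo - B * a hi\<close> and the boundary
    terms at most \<open>B * a hi + B * a lo\<close>; the terms at \<open>hi\<close> cancel.\<close>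
  ultimately have "cmod (integral {lo..hi} ?f) \<le> (G hi - G lo) + 2 * (B * a lo)"
    using lh by (smt (verit, best) atLeastAtMost_iff)
  moreover have "B * a lo \<le> B"
    using a_le[of lo] q_le[of lo] lh by (simp add: mult_left_le)
  moreover have "0 \<le> B" using q_le[of lo] lh by simp
  ultimately show ?thesis using V by linarith
qed

text \<open>With \<open>q = 1 / \<phi>'\<close> the defect \<open>1 - \<phi>' * q\<close> vanishes.
  Since \<open>\<phi>''\<close> keeps its sign, \<open>\<bar>q'\<bar>\<close> is the derivative of
  \<open>- \<sigma> / \<phi>'\<close>, whose increment is at most
  \<open>2 / \<delta>\<close>.\<close>

lemma van_der_Corput_first:
  fixes \<phi> \<phi>' \<phi>'' a a' :: "real \<Rightarrow> real"
  assumes "lo \<le> hi"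
    and "\<And>x. x \<in> {lo..hi} \<Longrightarrow> (\<phi> has_real_derivative \<phi>' x) (at x)"
    and \<phi>'': "\<And>x. x \<in> {lo..hi} \<Longrightarrow> (\<phi>' has_real_derivative \<phi>'' x) (at x)"
    and "\<And>x. x \<in> {lo..hi} \<Longrightarrow> (a has_real_derivative a' x) (at x)"
    and "\<And>x. x \<in> {lo..hi} \<Longrightarrow> 0 \<le> a x \<and> a x \<le> 1"
    and "\<And>x. x \<in> {lo..hi} \<Longrightarrow> a' x \<le> 0"
    and sgn: "\<bar>\<sigma>\<bar> = 1" "\<And>x. x \<in> {lo..hi} \<Longrightarrow> \<sigma> * \<phi>'' x \<ge> 0"
    and \<delta>: "\<delta> > 0" "\<And>x. x \<in> {lo..hi} \<Longrightarrow> \<bar>\<phi>' x\<bar> \<ge> \<delta>"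
  shows "cmod (integral {lo..hi} (\<lambda>x. cis (\<phi> x) * complex_of_real (a x))) \<le> 5 / \<delta>"
proof -
  have nz: "\<phi>' x \<noteq> 0" if "x \<in> {lo..hi}" for x using \<delta> that by fastforce
  have q_le: "\<bar>1 / \<phi>' x\<bar> \<le> 1 / \<delta>" if "x \<in> {lo..hi}" for x
    using \<delta>(1) \<delta>(2)[OF that] by (simp add: frac_le)
  have "\<bar>\<sigma> / \<phi>' x\<bar> \<le> 1 / \<delta>" if "x \<in> {lo..hi}" for x
    using q_le[OF that] sgn(1) by (simp add: abs_divide)
  from this[of lo] this[of hi] assms(1)
  have V: "- \<sigma> / \<phi>' hi - - \<sigma> / \<phi>' lo \<le> 2 / \<delta>"
    unfolding abs_le_iff by auto
  have abs_eq: "\<bar>\<phi>'' x\<bar> = \<sigma> * \<phi>'' x" if "x \<in> {lo..hi}" for x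
    using sgn(1) sgn(2)[OF that] by (metis abs_mult abs_of_nonneg mult_1)
  have "cmod (integral {lo..hi} (\<lambda>x. cis (\<phi> x) * complex_of_real (a x))) \<le> 3 * (1 / \<delta>) + 2 / \<delta>"
  proof (rule oscillatory_integral_bound[where q = "\<lambda>x. 1 / \<phi>' x" and G = "\<lambda>x. - \<sigma> / \<phi>' x"
        and q' = "\<lambda>x. - \<phi>'' x / (\<phi>' x)\<^sup>2" and G' = "\<lambda>x. \<sigma> * \<phi>'' x / (\<phi>' x)\<^sup>2"])
    fix x assume x: "x \<in> {lo..hi}"
    show "((\<lambda>x. 1 / \<phi>' x) has_real_derivative - \<phi>'' x / (\<phi>' x)\<^sup>2) (at x)"
      "((\<lambda>x. - \<sigma> / \<phi>' x) has_real_derivative \<sigma> * \<phi>'' x / (\<phi>' x)\<^sup>2) (at x)"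
      using \<phi>''[OF x] nz[OF x] by (auto intro!: derivative_eq_intros simp: power2_eq_square)
    show "\<bar>1 - \<phi>' x * (1 / \<phi>' x)\<bar> + \<bar>- \<phi>'' x / (\<phi>' x)\<^sup>2\<bar> \<le> \<sigma> * \<phi>'' x / (\<phi>' x)\<^sup>2"
      using nz[OF x] abs_eq[OF x] by (simp add: abs_divide)
  qed (use assms q_le V in auto)
  then show ?thesis by simp
qed

text \<open>With \<open>q = \<phi>'/(\<phi>'\<^sup>2 + \<mu>)\<close> no splitting at the stationary point is needed.\<close>

lemma van_der_Corput_second:
  fixes \<phi> \<phi>' \<phi>'' a a' :: "real \<Rightarrow> real"
  assumes "lo \<le> hi"
    and "\<And>x. x \<in> {lo..hi} \<Longrightarrow> (\<phi> has_real_derivative \<phi>' x) (at x)"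
    and \<phi>'': "\<And>x. x \<in> {lo..hi} \<Longrightarrow> (\<phi>' has_real_derivative \<phi>'' x) (at x)"
    and "\<And>x. x \<in> {lo..hi} \<Longrightarrow> (a has_real_derivative a' x) (at x)"
    and "\<And>x. x \<in> {lo..hi} \<Longrightarrow> 0 \<le> a x \<and> a x \<le> 1"
    and "\<And>x. x \<in> {lo..hi} \<Longrightarrow> a' x \<le> 0"
    and sgn: "\<bar>\<sigma>\<bar> = 1" "\<mu> > 0" "\<And>x. x \<in> {lo..hi} \<Longrightarrow> \<sigma> * \<phi>'' x \<ge> \<mu>"
  shows "cmod (integral {lo..hi} (\<lambda>x. cis (\<phi> x) * complex_of_real (a x))) \<le> 8 / sqrt \<mu>"
proof -
  let ?r = "sqrt \<mu>"
  let ?q = "\<lambda>x. \<phi>' x / ((\<phi>' x)\<^sup>2 + \<mu>)"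
  \<comment> \<open>The derivative of \<open>?G\<close> is
    \<open>2 * \<sigma> * \<phi>'' / (\<phi>'\<^sup>2 + \<mu>)\<close>. Boundedness of the
    arctangent keeps its increment below \<open>2 * pi / ?r\<close>, however large
    \<open>\<phi>'\<close> becomes.\<close>
  let ?G = "\<lambda>x. 2 * \<sigma> * arctan (\<phi>' x / ?r) / ?r"
  have r: "?r > 0" "?r\<^sup>2 = \<mu>" using sgn(2) by simp_all
  have pos: "(\<phi>' x)\<^sup>2 + \<mu> > 0" for x using sgn(2) by (simp add: add_nonneg_pos)
  have q_le: "\<bar>?q x\<bar> \<le> 1 / (2 * ?r)" for x
  proof -
    have "\<bar>\<phi>' x\<bar> * (2 * ?r) \<le> \<bar>\<phi>' x\<bar>\<^sup>2 + ?r\<^sup>2"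
      using sum_squares_bound[of "\<bar>\<phi>' x\<bar>" ?r] by (simp add: mult_ac)
    then show ?thesis using r pos[of x] by (simp add: abs_divide field_simps)
  qed
  have "\<bar>\<sigma> * arctan y\<bar> \<le> pi / 2" for y
    using sgn(1) arctan_bounded[of y] unfolding abs_mult by (auto simp: abs_le_iff)
  then have s: "\<sigma> * arctan y - \<sigma> * arctan z \<le> pi" for y z
    by (smt (verit, best) field_sum_of_halves)
  have "?G hi - ?G lo = 2 * (\<sigma> * arctan (\<phi>' hi / ?r) - \<sigma> * arctan (\<phi>' lo / ?r)) / ?r"
    by (simp add: diff_divide_distrib algebra_simps)
  also have "\<dots> \<le> 2 * pi / ?r"
    using s[of "\<phi>' hi / ?r" "\<phi>' lo / ?r"] r
    by (intro divide_right_mono mult_left_mono) auto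
  finally have V: "?G hi - ?G lo \<le> 2 * pi / ?r" .
  have abs_eq: "\<bar>\<phi>'' x\<bar> = \<sigma> * \<phi>'' x" if "x \<in> {lo..hi}" for x
    using sgn(1,2) sgn(3)[OF that] by (auto simp: abs_if split: if_splits)
  have "cmod (integral {lo..hi} (\<lambda>x. cis (\<phi> x) * complex_of_real (a x)))
      \<le> 3 * (1 / (2 * ?r)) + 2 * pi / ?r"
  proof (rule oscillatory_integral_bound[where q = ?q and G = ?G
        and q' = "\<lambda>x. \<phi>'' x * (\<mu> - (\<phi>' x)\<^sup>2) / ((\<phi>' x)\<^sup>2 + \<mu>)\<^sup>2"
        and G' = "\<lambda>x. 2 * \<sigma> * \<phi>'' x / ((\<phi>' x)\<^sup>2 + \<mu>)"])
    fix x assume x: "x \<in> {lo..hi}"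
    show "(?q has_real_derivative \<phi>'' x * (\<mu> - (\<phi>' x)\<^sup>2) / ((\<phi>' x)\<^sup>2 + \<mu>)\<^sup>2) (at x)"
      using \<phi>''[OF x] pos[of x]
      by (auto intro!: derivative_eq_intros simp: power2_eq_square) (simp add: algebra_simps)
    have "inverse (1 + (\<phi>' x / ?r)\<^sup>2) / \<mu> = 1 / ((\<phi>' x)\<^sup>2 + \<mu>)"
      using r pos[of x] sgn(2) by (simp add: power_divide divide_simps)
    moreover have "?r * ?r = \<mu>" using sgn(2) by simp
    moreover have "(?G has_real_derivative
        2 * \<sigma> * (inverse (1 + (\<phi>' x / ?r)\<^sup>2) * (\<phi>'' x / ?r)) / ?r) (at x)"
      by (intro DERIV_cdivide DERIV_cmult DERIV_chain2[OF DERIV_arctan] \<phi>''[OF x])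
    moreover have "2 * \<sigma> * (inverse (1 + (\<phi>' x / ?r)\<^sup>2) * (\<phi>'' x / ?r)) / ?r
        = 2 * \<sigma> * \<phi>'' x * (inverse (1 + (\<phi>' x / ?r)\<^sup>2) / (?r * ?r))"
      by simp
    ultimately show "(?G has_real_derivative 2 * \<sigma> * \<phi>'' x / ((\<phi>' x)\<^sup>2 + \<mu>)) (at x)" by simp
    \<comment> \<open>The lower bound \<open>\<mu> \<le> \<sigma> * \<phi>'' x\<close> replaces the
      numerator \<open>\<mu>\<close> of the defect by \<open>\<sigma> * \<phi>'' x\<close>. The
      defect and \<open>\<bar>q'\<bar>\<close> then each take half of the derivative of
      \<open>?G\<close>.\<close>
    have "1 - \<phi>' x * ?q x = \<mu> / ((\<phi>' x)\<^sup>2 + \<mu>)"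
      using pos[of x] by (simp add: field_simps power2_eq_square)
    then have "\<bar>1 - \<phi>' x * ?q x\<bar> \<le> \<sigma> * \<phi>'' x / ((\<phi>' x)\<^sup>2 + \<mu>)"
      using pos[of x] sgn(2) sgn(3)[OF x] by (simp add: divide_right_mono)
    moreover have "\<bar>\<phi>'' x * (\<mu> - (\<phi>' x)\<^sup>2) / ((\<phi>' x)\<^sup>2 + \<mu>)\<^sup>2\<bar> \<le> \<sigma> * \<phi>'' x / ((\<phi>' x)\<^sup>2 + \<mu>)"
    proof -
      have "\<bar>\<mu> - (\<phi>' x)\<^sup>2\<bar> \<le> (\<phi>' x)\<^sup>2 + \<mu>" using sgn(2) by (simp add: abs_le_iff)
      then have "\<bar>\<phi>'' x\<bar> * \<bar>\<mu> - (\<phi>' x)\<^sup>2\<bar> / ((\<phi>' x)\<^sup>2 + \<mu>)\<^sup>2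
          \<le> \<bar>\<phi>'' x\<bar> * ((\<phi>' x)\<^sup>2 + \<mu>) / ((\<phi>' x)\<^sup>2 + \<mu>)\<^sup>2"
        by (intro divide_right_mono mult_left_mono) auto
      then show ?thesis using pos[of x] abs_eq[OF x]
        by (simp add: abs_mult power2_eq_square)
    qed
    ultimately show "\<bar>1 - \<phi>' x * ?q x\<bar> + \<bar>\<phi>'' x * (\<mu> - (\<phi>' x)\<^sup>2) / ((\<phi>' x)\<^sup>2 + \<mu>)\<^sup>2\<bar>
        \<le> 2 * \<sigma> * \<phi>'' x / ((\<phi>' x)\<^sup>2 + \<mu>)" by linarith
  qed (use assms q_le V in auto)
  also have "\<dots> = (3 / 2 + 2 * pi) / ?r" by (simp add: add_divide_distrib)
  also have "\<dots> \<le> 8 / ?r"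
    using r pi_less_4 pi_approx by (intro divide_right_mono) auto
  finally show ?thesis .
qed

section \<open>Discrete Frostman weights\<close>

text \<open>Points are added one at a time, each with the largest mass that no budget forbids, which
  saturates some set through the new point. A set that was saturated before stays so: its mass
  cannot decrease, and it still respects the budget.\<close>

lemma frostman_greedy:
  fixes c :: "'a set \<Rightarrow> real"
  assumes "finite P" "finite \<I>" "P \<subseteq> \<Union>\<I>" "\<And>U. U \<in> \<I> \<Longrightarrow> 0 \<le> c U"
  shows "\<exists>w. (\<forall>p. 0 \<le> w p) \<and> (\<forall>U\<in>\<I>. sum w (P \<inter> U) \<le> c U) \<and>
    (\<forall>p\<in>P. \<exists>U\<in>\<I>. p \<in> U \<and> sum w (P \<inter> U) = c U)"
  using assms(1,3)
proof (induction P)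
  case empty
  then show ?case using assms(4) by (intro exI[of _ "\<lambda>_. 0"]) auto
next
  case (insert x P)
  from insert.prems have "P \<subseteq> \<Union>\<I>" by simp
  from insert.IH[OF this] obtain w
    where w0: "\<And>p. 0 \<le> w p" and w_le: "\<And>U. U \<in> \<I> \<Longrightarrow> sum w (P \<inter> U) \<le> c U"
      and w_tight: "\<And>p. p \<in> P \<Longrightarrow> \<exists>U\<in>\<I>. p \<in> U \<and> sum w (P \<inter> U) = c U" by blast
  define \<J> where "\<J> = {U \<in> \<I>. x \<in> U}"
  have \<J>: "finite \<J>" "\<J> \<noteq> {}" using insert.prems assms(2) by (auto simp: \<J>_def)
  \<comment> \<open>The smallest room left among the sets through \<open>x\<close>; the minimum is
    attained at a set \<open>V\<close>, which becomes saturated.\<close>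
  define v where "v = Min ((\<lambda>U. c U - sum w (P \<inter> U)) ` \<J>)"
  have v_le: "v \<le> c U - sum w (P \<inter> U)" if "U \<in> \<I>" "x \<in> U" for U
    using \<J> that by (auto simp: v_def \<J>_def intro!: Min_le)
  have "v \<in> (\<lambda>U. c U - sum w (P \<inter> U)) ` \<J>"
    unfolding v_def using \<J> by (intro Min_in) auto
  then obtain V where V: "V \<in> \<I>" "x \<in> V" "v = c V - sum w (P \<inter> V)" by (auto simp: \<J>_def)
  have v0: "0 \<le> v" using V w_le[of V] by simp
  define w' where "w' = w(x := v)"
  have old: "sum w' (P \<inter> U) = sum w (P \<inter> U)" for U
    using insert.hyps by (intro sum.cong) (auto simp: w'_def)
  have new: "sum w' (insert x P \<inter> U) = (if x \<in> U then v + sum w (P \<inter> U) else sum w (P \<inter> U))" for U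
    using insert.hyps old[of U] by (auto simp: Int_insert_left) (simp add: w'_def)
  show ?case
  proof (intro exI[of _ w'] conjI ballI allI)
    show "0 \<le> w' p" for p using w0 v0 by (simp add: w'_def)
    show w'_le: "sum w' (insert x P \<inter> U) \<le> c U" if "U \<in> \<I>" for U
      using v_le[OF that] w_le[OF that] by (auto simp: new)
    fix p assume p: "p \<in> insert x P"
    show "\<exists>U\<in>\<I>. p \<in> U \<and> sum w' (insert x P \<inter> U) = c U"
    proof (cases "p = x")
      case True
      from V new[of V] have "sum w' (insert x P \<inter> V) = c V" by simp
      with True V show ?thesis by blast
    next
      case False
      with p w_tight obtain U where U: "U \<in> \<I>" "p \<in> U" "sum w (P \<inter> U) = c U" by blast
      with w'_le[of U] v0 have "sum w' (insert x P \<inter> U) = c U" by (auto simp: new split: if_splits)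
      with U show ?thesis by blast
    qed
  qed
qed

text \<open>A discrete Frostman lemma: by maximality of \<open>w\<close> each point lies in a saturated set,
  and the maximal saturated sets are disjoint.\<close>

lemma frostman_finite:
  fixes c :: "'a set \<Rightarrow> real"
  assumes "finite P" "finite \<I>" "P \<subseteq> \<Union>\<I>" "\<And>U. U \<in> \<I> \<Longrightarrow> 0 \<le> c U"
    and laminar: "\<And>U V. U \<in> \<I> \<Longrightarrow> V \<in> \<I> \<Longrightarrow> U \<subseteq> V \<or> V \<subseteq> U \<or> U \<inter> V = {}"
  obtains w \<C> where "\<And>p. 0 \<le> w p" "\<And>U. U \<in> \<I> \<Longrightarrow> sum w (P \<inter> U) \<le> c U"
    "\<C> \<subseteq> \<I>" "P \<subseteq> \<Union>\<C>" "sum c \<C> \<le> sum w P"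
proof -
  obtain w where w0: "\<And>p. 0 \<le> w p" and w_le: "\<And>U. U \<in> \<I> \<Longrightarrow> sum w (P \<inter> U) \<le> c U"
    and w_tight: "\<And>p. p \<in> P \<Longrightarrow> \<exists>U\<in>\<I>. p \<in> U \<and> sum w (P \<inter> U) = c U"
    using frostman_greedy[OF assms(1,2,3), of c] assms(4) by blast
  define \<T> where "\<T> = {U \<in> \<I>. sum w (P \<inter> U) = c U}"
  define \<C> where "\<C> = {U \<in> \<T>. \<forall>V\<in>\<T>. U \<subseteq> V \<longrightarrow> U = V}"
  have fin: "finite \<T>" "finite \<C>" using assms(2) by (simp_all add: \<T>_def \<C>_def)
  have sub: "\<C> \<subseteq> \<I>" by (auto simp: \<C>_def \<T>_def)
  have cov: "P \<subseteq> \<Union>\<C>"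
  proof
    fix p assume "p \<in> P"
    then obtain U where U: "U \<in> \<T>" "p \<in> U" using w_tight unfolding \<T>_def by blast
    from finite_has_maximal2[OF fin(1) U(1)] obtain V where "V \<in> \<T>" "U \<subseteq> V"
      "\<forall>W\<in>\<T>. V \<subseteq> W \<longrightarrow> V = W" by auto
    with U show "p \<in> \<Union>\<C>" by (auto simp: \<C>_def)
  qed
  have disj: "U \<inter> V = {}" if "U \<in> \<C>" "V \<in> \<C>" "U \<noteq> V" for U V
  proof -
    from that sub laminar have "U \<subseteq> V \<or> V \<subseteq> U \<or> U \<inter> V = {}" by blast
    with that show ?thesis unfolding \<C>_def by auto
  qed
  have "sum c \<C> = (\<Sum>U\<in>\<C>. sum w (P \<inter> U))"
    by (rule sum.cong) (auto simp: \<C>_def \<T>_def)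
  also have "\<dots> = sum w (\<Union>U\<in>\<C>. P \<inter> U)"
    using assms(1) fin disj by (intro sum.UNION_disjoint[symmetric]) auto
  also have "\<dots> \<le> sum w P"
    using assms(1) w0 by (intro sum_mono2) auto
  finally show ?thesis using that w0 w_le sub cov by blast
qed

section \<open>Dyadic grid intervals and potentials of weights on them\<close>

text \<open>Through the floor the cells are half-open and partition the line, and nesting of dyadic
  scales becomes integer division of indices.\<close>

definition grid_interval :: "real \<Rightarrow> int \<Rightarrow> real set" where
  "grid_interval r i = {x. \<lfloor>x / r\<rfloor> = i}"

lemma grid_interval_eq:
  assumes "r > 0"
  shows "grid_interval r i = {of_int i * r ..< (of_int i + 1) * r}"
  using assms by (auto simp: grid_interval_def floor_eq_iff field_simps)

lemma diameter_grid_interval: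
  assumes "r > 0"
  shows "bounded (grid_interval r i)" "diameter (grid_interval r i) = r"
proof -
  show "bounded (grid_interval r i)" using assms by (simp add: grid_interval_eq)
  have "of_int i * r < (of_int i + 1) * r" using assms by simp
  then have "closure (grid_interval r i) = {of_int i * r .. (of_int i + 1) * r}"
    using assms by (simp add: grid_interval_eq)
  then have "diameter (closure (grid_interval r i)) = r"
    using assms by (simp add: algebra_simps)
  then show "diameter (grid_interval r i) = r"
    using diameter_closure[of "grid_interval r i"] assms by (simp add: grid_interval_eq)
qed

text \<open>The index of a point at scale \<open>2 ^ l * r\<close> is its index at scale
  \<open>2 ^ k * r\<close> divided by \<open>2 ^ (l - k)\<close>, hence constant on each finer
  cell.\<close>

lemma grid_interval_laminar:
  assumes "r > 0" "k \<le> l"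
  shows "grid_interval (2 ^ k * r) i \<subseteq> grid_interval (2 ^ l * r) j \<or>
    grid_interval (2 ^ k * r) i \<inter> grid_interval (2 ^ l * r) j = {}"
proof -
  have *: "\<lfloor>x / (2 ^ l * r)\<rfloor> = \<lfloor>x / (2 ^ k * r)\<rfloor> div 2 ^ (l - k)" for x
  proof -
    have "x / (2 ^ l * r) = x / (2 ^ k * r) / real_of_int (2 ^ (l - k))"
      using assms power_add[of "2::real" "l - k" k] by (simp add: field_simps)
    then show ?thesis using floor_divide_real_eq_div[of "2 ^ (l - k)" "x / (2 ^ k * r)"]
      by (simp only:) simp
  qed
  show ?thesis unfolding grid_interval_def * by auto
qed

text \<open>The profile of the \<open>T T\<^sup>*\<close> kernel at distance \<open>D\<close>, with
  \<open>\<rho>\<close> the scale \<Lambda>^(-m); it is comparable to (1 + D / \<rho>)^(-1/2). The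
  case distinction gives 1 at \<open>D = 0\<close>, where the quotient \<open>\<rho> / D\<close> is
  0 by convention.\<close>

definition decay :: "real \<Rightarrow> real \<Rightarrow> real" where
  "decay \<rho> D = (if D < \<rho> then 1 else sqrt (\<rho> / D))"

text \<open>An open interval of length \<open>4 * r\<close> centred at \<open>x\<close> meets only
  the cell of \<open>x\<close> and its two neighbours on either side, five cells in all.\<close>

lemma sum_ball_le:
  fixes w :: "real \<Rightarrow> real"
  assumes "finite P" "\<And>p. 0 \<le> w p" "r > 0" "\<And>i. sum w (P \<inter> grid_interval r i) \<le> b"
  shows "sum w {y \<in> P. \<bar>x - y\<bar> < 2 * r} \<le> 5 * b"
proof -
  let ?I = "{\<lfloor>x / r\<rfloor> - 2..\<lfloor>x / r\<rfloor> + 2}"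
  have "{y \<in> P. \<bar>x - y\<bar> < 2 * r} \<subseteq> (\<Union>i\<in>?I. P \<inter> grid_interval r i)"
  proof safe
    fix y assume "y \<in> P" "\<bar>x - y\<bar> < 2 * r"
    then have "\<bar>x / r - y / r\<bar> < 2"
      using assms(3) by (simp add: abs_less_iff diff_divide_distrib[symmetric] field_simps)
    then have "\<lfloor>y / r\<rfloor> \<in> ?I" by (simp only: atLeastAtMost_iff abs_less_iff) linarith
    with \<open>y \<in> P\<close> show "y \<in> (\<Union>i\<in>?I. P \<inter> grid_interval r i)"
      by (auto simp: grid_interval_def)
  qed
  then have "sum w {y \<in> P. \<bar>x - y\<bar> < 2 * r} \<le> sum w (\<Union>i\<in>?I. P \<inter> grid_interval r i)"
    using assms by (intro sum_mono2) auto
  also have "\<dots> = (\<Sum>i\<in>?I. sum w (P \<inter> grid_interval r i))"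
    using assms by (intro sum.UNION_disjoint) (auto simp: grid_interval_def)
  also have "\<dots> \<le> (\<Sum>i\<in>?I. b)" by (intro sum_mono assms)
  finally show ?thesis by simp
qed

text \<open>One term suffices: for the least \<open>k\<close> with
  \<open>D < 2 ^ Suc k * \<rho>\<close>, either \<open>D < \<rho>\<close> and \<open>k = 0\<close>,
  or \<open>D\<close> is at least \<open>2 ^ k * \<rho>\<close> and the square root is at most
  2^(-k/2).\<close>

lemma decay_le_dyadic_sum:
  assumes "\<rho> > 0" "0 \<le> D" "D < 2 ^ Suc n * \<rho>"
  shows "decay \<rho> D \<le> (\<Sum>k\<le>n. (1 / sqrt 2) ^ k * of_bool (D < 2 ^ Suc k * \<rho>))"
proof -
  define k where "k = (LEAST k. D < 2 ^ Suc k * \<rho>)"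
  have k: "D < 2 ^ Suc k * \<rho>" "k \<le> n"
    unfolding k_def using LeastI[of "\<lambda>k. D < 2 ^ Suc k * \<rho>"] Least_le[of "\<lambda>k. D < 2 ^ Suc k * \<rho>"] assms by auto
  have "decay \<rho> D \<le> (1 / sqrt 2) ^ k"
  proof (cases "D < \<rho>")
    case True
    then have "D < 2 ^ Suc 0 * \<rho>" using assms by simp
    then have "k = 0" unfolding k_def by (rule Least_eq_0)
    with True show ?thesis by (simp add: decay_def)
  next
    case False
    have "2 ^ k * \<rho> \<le> D"
    proof (cases k)
      case 0 with False show ?thesis by simp
    next
      case (Suc l)
      then have "\<not> D < 2 ^ Suc l * \<rho>" using not_less_Least[of l "\<lambda>k. D < 2 ^ Suc k * \<rho>"] by (simp add: k_def)
      with Suc show ?thesis by simp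
    qed
    moreover have "D > 0" using False assms by linarith
    ultimately have "\<rho> / D \<le> 1 / 2 ^ k" using assms by (simp add: field_simps)
    then have "sqrt (\<rho> / D) \<le> sqrt (1 / 2 ^ k)" by (rule real_sqrt_le_mono)
    with False show ?thesis by (simp add: decay_def real_sqrt_divide real_sqrt_power power_one_over)
  qed
  also have "\<dots> = (\<Sum>k\<in>{k}. (1 / sqrt 2) ^ k * of_bool (D < 2 ^ Suc k * \<rho>))" using k by simp
  also have "\<dots> \<le> (\<Sum>k\<le>n. (1 / sqrt 2) ^ k * of_bool (D < 2 ^ Suc k * \<rho>))"
    using k by (intro sum_mono2) auto
  finally show ?thesis .
qed

text \<open>The hypothesis \<open>\<alpha> < 1/2\<close> makes the smallest scale \<open>\<rho>\<close> dominate.\<close>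

lemma frostman_potential_bound:
  fixes w :: "real \<Rightarrow> real"
  assumes P: "finite P" and w: "\<And>p. 0 \<le> w p" and \<rho>: "\<rho> > 0" and \<alpha>: "\<alpha> < 1 / 2"
    and w_le: "\<And>k i. k \<le> n \<Longrightarrow> sum w (P \<inter> grid_interval (2 ^ k * \<rho>) i) \<le> (2 ^ k * \<rho>) powr \<alpha>"
    and bd: "\<And>p. p \<in> P \<Longrightarrow> \<bar>p\<bar> < 2 ^ n * \<rho>" and x: "x \<in> P"
  shows "(\<Sum>y\<in>P. w y * decay \<rho> \<bar>x - y\<bar>) \<le> 5 / (1 - 2 powr (\<alpha> - 1 / 2)) * \<rho> powr \<alpha>"
proof -
  \<comment> \<open>From one dyadic scale to the next the kernel gains a factor 2^(-1/2) while the
    admissible mass grows by 2^\<alpha>; their product \<open>q\<close> is the ratio of a convergent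
    geometric series.\<close>
  define q :: real where "q = 2 powr (\<alpha> - 1 / 2)"
  have q: "0 < q" "q < 1" using \<alpha> by (auto simp: q_def powr_less_one)
  have q_pow: "(1 / sqrt 2) ^ k * (2 ^ k * \<rho>) powr \<alpha> = q ^ k * \<rho> powr \<alpha>" for k
  proof -
    have "(1 / sqrt 2) * 2 powr \<alpha> = q"
      by (simp add: q_def powr_diff powr_half_sqrt)
    then have "q ^ k = (1 / sqrt 2) ^ k * (2 powr \<alpha>) ^ k" by (metis power_mult_distrib)
    also have "(2 powr \<alpha>) ^ k = (2 ^ k :: real) powr \<alpha>"
      by (simp add: powr_powr flip: powr_realpow) (simp add: mult.commute)
    finally show ?thesis using \<rho> by (simp add: powr_mult)
  qed
  have "(\<Sum>y\<in>P. w y * decay \<rho> \<bar>x - y\<bar>)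
      \<le> (\<Sum>y\<in>P. w y * (\<Sum>k\<le>n. (1 / sqrt 2) ^ k * of_bool (\<bar>x - y\<bar> < 2 ^ Suc k * \<rho>)))"
  proof (intro sum_mono mult_left_mono decay_le_dyadic_sum \<rho> w)
    fix y assume "y \<in> P"
    with bd[of y] bd[OF x] show "\<bar>x - y\<bar> < 2 ^ Suc n * \<rho>" by simp
  qed simp
  also have "\<dots> = (\<Sum>k\<le>n. (1 / sqrt 2) ^ k * sum w {y \<in> P. \<bar>x - y\<bar> < 2 * (2 ^ k * \<rho>)})"
  proof -
    have "(\<Sum>y\<in>P. w y * of_bool (\<bar>x - y\<bar> < 2 ^ Suc k * \<rho>)) = sum w {y \<in> P. \<bar>x - y\<bar> < 2 * (2 ^ k * \<rho>)}" for k
      using P by (intro sum.mono_neutral_cong_right) auto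
    moreover have "(\<Sum>y\<in>P. w y * (\<Sum>k\<le>n. (1 / sqrt 2) ^ k * of_bool (\<bar>x - y\<bar> < 2 ^ Suc k * \<rho>)))
       = (\<Sum>k\<le>n. (1 / sqrt 2) ^ k * (\<Sum>y\<in>P. w y * of_bool (\<bar>x - y\<bar> < 2 ^ Suc k * \<rho>)))"
      unfolding sum_distrib_left by (subst sum.swap) (simp only: mult_ac)
    ultimately show ?thesis by simp
  qed
  also have "\<dots> \<le> (\<Sum>k\<le>n. (1 / sqrt 2) ^ k * (5 * (2 ^ k * \<rho>) powr \<alpha>))"
    using \<rho> by (intro sum_mono mult_left_mono sum_ball_le P w w_le) auto
  also have "\<dots> = (\<Sum>k\<le>n. 5 * ((1 / sqrt 2) ^ k * (2 ^ k * \<rho>) powr \<alpha>))"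
    by (simp only: mult_ac)
  also have "\<dots> = 5 * \<rho> powr \<alpha> * (\<Sum>k\<le>n. q ^ k)"
    unfolding q_pow by (simp add: sum_distrib_left mult_ac)
  also have "(\<Sum>k\<le>n. q ^ k) \<le> 1 / (1 - q)"
    using sum_le_suminf[of "\<lambda>k. q ^ k" "{..n}"] q suminf_geometric[of q] by simp
  finally have "(\<Sum>y\<in>P. w y * decay \<rho> \<bar>x - y\<bar>) \<le> 5 * \<rho> powr \<alpha> * (1 / (1 - q))"
    by (simp add: mult_left_mono)
  then show ?thesis by (simp add: q_def mult_ac)
qed

text \<open>The budget of a cell is its diameter to the power \<open>\<alpha>\<close>. Only the
  finitely many cells of scales 0 to \<open>n\<close> that contain a point of \<open>P\<close> enter
  the family, since any other cell carries no mass. The cells of scale 0 make the family cover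
  \<open>P\<close>.\<close>

lemma frostman_grid:
  fixes P :: "real set"
  assumes P: "finite P" and \<rho>: "\<rho> > 0"
  obtains w \<C> where "\<And>p. 0 \<le> w p"
    "\<And>k i. k \<le> n \<Longrightarrow> sum w (P \<inter> grid_interval (2 ^ k * \<rho>) i) \<le> (2 ^ k * \<rho>) powr \<alpha>"
    "finite \<C>" "\<And>U. U \<in> \<C> \<Longrightarrow> \<exists>k i. U = grid_interval (2 ^ k * \<rho>) i"
    "P \<subseteq> \<Union>\<C>" "(\<Sum>U\<in>\<C>. diameter U powr \<alpha>) \<le> sum w P"
proof -
  define \<I> where "\<I> = (\<lambda>(k, p). grid_interval (2 ^ k * \<rho>) \<lfloor>p / (2 ^ k * \<rho>)\<rfloor>) ` ({..n} \<times> P)"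
  have I_grid: "\<exists>k i. U = grid_interval (2 ^ k * \<rho>) i" if "U \<in> \<I>" for U
    using that by (auto simp: \<I>_def)
  have fin: "finite \<I>" unfolding \<I>_def using P by simp
  have cov: "P \<subseteq> \<Union>\<I>"
  proof
    fix p assume "p \<in> P"
    then have "grid_interval (2 ^ 0 * \<rho>) \<lfloor>p / (2 ^ 0 * \<rho>)\<rfloor> \<in> \<I>"
      unfolding \<I>_def by (intro image_eqI[of _ _ "(0, p)"]) auto
    moreover have "p \<in> grid_interval (2 ^ 0 * \<rho>) \<lfloor>p / (2 ^ 0 * \<rho>)\<rfloor>"
      by (simp add: grid_interval_def)
    ultimately     show "p \<in> \<Union>\<I>" by blast
  qed
  have lam: "U \<subseteq> V \<or> V \<subseteq> U \<or> U \<inter> V = {}" if "U \<in> \<I>" "V \<in> \<I>" for U V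
    using I_grid[OF that(1)] I_grid[OF that(2)] grid_interval_laminar[OF \<rho>]
    by (metis inf_commute linorder_le_cases)
  obtain w \<C> where w: "\<And>p. 0 \<le> w p" "\<And>U. U \<in> \<I> \<Longrightarrow> sum w (P \<inter> U) \<le> diameter U powr \<alpha>"
    and C: "\<C> \<subseteq> \<I>" "P \<subseteq> \<Union>\<C>" "(\<Sum>U\<in>\<C>. diameter U powr \<alpha>) \<le> sum w P"
    using frostman_finite[OF P fin cov, of "\<lambda>U. diameter U powr \<alpha>"] lam by auto
  show ?thesis
  proof (rule that[of w \<C>])
    fix k i assume k: "k \<le> n"
    have r: "2 ^ k * \<rho> > 0" using \<rho> by simp
    show "sum w (P \<inter> grid_interval (2 ^ k * \<rho>) i) \<le> (2 ^ k * \<rho>) powr \<alpha>"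
    proof (cases "P \<inter> grid_interval (2 ^ k * \<rho>) i = {}")
      case True then show ?thesis by (simp only: sum.empty) simp
    next
      case False
      then obtain p where "p \<in> P" "\<lfloor>p / (2 ^ k * \<rho>)\<rfloor> = i" by (auto simp: grid_interval_def)
      then have "grid_interval (2 ^ k * \<rho>) i \<in> \<I>" using k by (force simp: \<I>_def image_iff)
      from w(2)[OF this] show ?thesis by (simp add: diameter_grid_interval[OF r])
    qed
  qed (use w C I_grid fin finite_subset in blast)+
qed

section \<open>Duality between large values and kernel sums\<close>

text \<open>The \<open>T T\<^sup>*\<close> argument; Cauchy--Schwarz is replaced by \<open>2 |F| |g| \<le> \<tau> |F|\<^sup>2 + |g|\<^sup>2 / \<tau>\<close>.\<close>

lemma weighted_large_values:
  fixes h :: "'p \<Rightarrow> 'x \<Rightarrow> complex" and g :: "'x \<Rightarrow> complex" and w :: "'p \<Rightarrow> real"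
  assumes P: "finite P" and h_meas: "\<And>p. p \<in> P \<Longrightarrow> h p \<in> borel_measurable M"
    and h_int: "\<And>p q. p \<in> P \<Longrightarrow> q \<in> P \<Longrightarrow> integrable M (\<lambda>x. h p x * cnj (h q x))"
    and g_meas: "g \<in> borel_measurable M" and g_int: "integrable M (\<lambda>x. (cmod (g x))\<^sup>2)"
    and w: "\<And>p. 0 \<le> w p" and \<eta>: "\<eta> > 0"
    and large: "\<And>p. p \<in> P \<Longrightarrow> \<eta> \<le> cmod (LINT x|M. h p x * g x)"
    and B: "B > 0" "\<And>p. p \<in> P \<Longrightarrow> (\<Sum>q\<in>P. w q * cmod (LINT x|M. h p x * cnj (h q x))) \<le> B"
  shows "sum w P \<le> B / \<eta>\<^sup>2 * (LINT x|M. (cmod (g x))\<^sup>2)"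
proof -
  define I where "I p = (LINT x|M. h p x * g x)" for p
  \<comment> \<open>The phases \<open>u\<close> rotate every \<open>I p\<close> onto the nonnegative
    axis, so that pairing \<open>F\<close> with \<open>g\<close> adds the moduli without
    cancellation.\<close>
  define u where "u p = cnj (sgn (I p))" for p
  define F where "F x = (\<Sum>p\<in>P. complex_of_real (w p) * u p * h p x)" for x
  let ?G = "LINT x|M. (cmod (g x))\<^sup>2"
  have u: "cmod (u p) \<le> 1" for p by (simp add: u_def norm_sgn)
  have uI: "u p * I p = complex_of_real (cmod (I p))" for p
  proof (cases "I p = 0")
    case False
    have "cnj (I p) * I p = (complex_of_real (cmod (I p)))\<^sup>2"
      using complex_norm_square[of "I p"] by (simp add: mult.commute)
    with False show ?thesis by (simp add: u_def sgn_div_norm scaleR_conv_of_real power2_eq_square field_simps)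
  qed simp
  have hg_int: "integrable M (\<lambda>x. h p x * g x)" if p: "p \<in> P" for p
  proof (rule Bochner_Integration.integrable_bound)
    have "integrable M (\<lambda>x. Re (h p x * cnj (h p x)))"
      using h_int[OF p p] by (rule integrable_Re)
    then have "integrable M (\<lambda>x. (cmod (h p x))\<^sup>2)"
      by (simp add: complex_mult_cnj cmod_power2)
    then show "integrable M (\<lambda>x. (cmod (h p x))\<^sup>2 + (cmod (g x))\<^sup>2)"
      using g_int by (rule Bochner_Integration.integrable_add)
    show "(\<lambda>x. h p x * g x) \<in> borel_measurable M" using h_meas[OF p] g_meas by measurable
    have "cmod (h p x * g x) \<le> (cmod (h p x))\<^sup>2 + (cmod (g x))\<^sup>2" for x
      using sum_squares_bound[of "cmod (h p x)" "cmod (g x)"]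
        mult_nonneg_nonneg[of "cmod (h p x)" "cmod (g x)"]
      by (simp add: norm_mult del: mult_nonneg_nonneg)
    then show "AE x in M. norm (h p x * g x) \<le> norm ((cmod (h p x))\<^sup>2 + (cmod (g x))\<^sup>2)"
      by (intro AE_I2) (smt (verit) real_norm_def)
  qed
  have FF: "F x * cnj (F x) = (\<Sum>p\<in>P. \<Sum>q\<in>P. (complex_of_real (w p) * u p * complex_of_real (w q) * cnj (u q)) * (h p x * cnj (h q x)))" for x
    by (simp add: F_def cnj_sum sum_product mult_ac)
  have FF_int: "integrable M (\<lambda>x. F x * cnj (F x))"
    unfolding FF by (intro Bochner_Integration.integrable_sum integrable_mult_right h_int)
  have F2: "complex_of_real ((cmod (F x))\<^sup>2) = F x * cnj (F x)" for x
    using complex_norm_square[of "F x"] by simp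
  have F2_int: "integrable M (\<lambda>x. (cmod (F x))\<^sup>2)"
    using integrable_Re[OF FF_int] by (simp flip: F2)
  have Fg: "F x * g x = (\<Sum>p\<in>P. (complex_of_real (w p) * u p) * (h p x * g x))" for x
    by (simp add: F_def sum_distrib_right mult.assoc)
  have Fg_int: "integrable M (\<lambda>x. F x * g x)"
    unfolding Fg by (intro Bochner_Integration.integrable_sum integrable_mult_right hg_int)
  \<comment> \<open>Expanding the square produces the kernel matrix; each of its weighted row sums
    is at most \<open>B\<close>, and the outer sum contributes the total mass.\<close>
  have Q: "(LINT x|M. (cmod (F x))\<^sup>2) \<le> sum w P * B"
  proof -
    have "(LINT x|M. (cmod (F x))\<^sup>2) = cmod (LINT x|M. F x * cnj (F x))"
      unfolding F2[symmetric] integral_complex_of_real by simp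
    also have "(LINT x|M. F x * cnj (F x)) = (\<Sum>p\<in>P. \<Sum>q\<in>P.
        (complex_of_real (w p) * u p * complex_of_real (w q) * cnj (u q)) * (LINT x|M. h p x * cnj (h q x)))"
      unfolding FF by (simp add: h_int)
    also have "cmod \<dots> \<le> (\<Sum>p\<in>P. \<Sum>q\<in>P. w p * (w q * cmod (LINT x|M. h p x * cnj (h q x))))"
    proof (intro order_trans[OF norm_sum] sum_mono order_trans[OF norm_sum])
      fix p q
      have "cmod (u p) * cmod (u q) \<le> 1" using u[of p] u[of q] by (simp add: mult_le_one)
      from mult_left_mono[OF this, of "w p * (w q * cmod (LINT x|M. h p x * cnj (h q x)))"] w
      show "cmod ((complex_of_real (w p) * u p * complex_of_real (w q) * cnj (u q)) * (LINT x|M. h p x * cnj (h q x)))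
        \<le> w p * (w q * cmod (LINT x|M. h p x * cnj (h q x)))"
        by (simp add: norm_mult mult_ac)
    qed
    also have "\<dots> = (\<Sum>p\<in>P. w p * (\<Sum>q\<in>P. w q * cmod (LINT x|M. h p x * cnj (h q x))))"
      by (simp add: sum_distrib_left)
    also have "\<dots> \<le> (\<Sum>p\<in>P. w p * B)" by (intro sum_mono mult_left_mono B w)
    finally show ?thesis by (simp add: sum_distrib_right)
  qed
  have "\<eta> * sum w P \<le> (\<Sum>p\<in>P. w p * cmod (I p))"
    unfolding sum_distrib_left
  proof (rule sum_mono)
    fix p assume "p \<in> P"
    from mult_left_mono[OF large[OF this] w[of p]]
    show "\<eta> * w p \<le> w p * cmod (I p)" unfolding I_def by (simp only: mult.commute)
  qed
  also have "\<dots> = cmod (\<Sum>p\<in>P. complex_of_real (w p) * u p * I p)"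
  proof -
    have "(\<Sum>p\<in>P. complex_of_real (w p) * u p * I p) = complex_of_real (\<Sum>p\<in>P. w p * cmod (I p))"
      by (simp add: uI mult.assoc)
    then show ?thesis using w by (simp add: sum_nonneg del: of_real_sum of_real_mult)
  qed
  also have "(\<Sum>p\<in>P. complex_of_real (w p) * u p * I p) = (LINT x|M. F x * g x)"
    unfolding Fg I_def by (simp add: hg_int)
  also have "cmod \<dots> \<le> (LINT x|M. cmod (F x * g x))" by (rule integral_norm_bound)
  \<comment> \<open>With \<tau> = \<open>\<eta> / B\<close> the term in \<open>F\<close> becomes at
    most half of \<open>\<eta> * sum w P\<close>, which is then absorbed into the left-hand
    side.\<close>
  also have "\<dots> \<le> (LINT x|M. (\<eta> / B * (cmod (F x))\<^sup>2 + B / \<eta> * (cmod (g x))\<^sup>2) / 2)"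
  proof (intro integral_mono integrable_norm Fg_int integrable_divide Bochner_Integration.integrable_add
      integrable_mult_right F2_int g_int)
    fix x
    have "0 \<le> \<eta> / B * (cmod (F x) - B / \<eta> * cmod (g x))\<^sup>2" using \<eta> B by simp
    also have "\<eta> / B * (cmod (F x) - B / \<eta> * cmod (g x))\<^sup>2
        = \<eta> / B * (cmod (F x))\<^sup>2 - 2 * (cmod (F x) * cmod (g x)) + B / \<eta> * (cmod (g x))\<^sup>2"
      using \<eta> B by (simp add: power2_diff field_simps power2_eq_square)
    finally show "cmod (F x * g x) \<le> (\<eta> / B * (cmod (F x))\<^sup>2 + B / \<eta> * (cmod (g x))\<^sup>2) / 2"
      by (simp add: norm_mult)
  qed
  also have "\<dots> = (\<eta> / B * (LINT x|M. (cmod (F x))\<^sup>2) + B / \<eta> * ?G) / 2"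
    using F2_int g_int by simp
  also have "\<dots> \<le> (\<eta> / B * (sum w P * B) + B / \<eta> * ?G) / 2"
    using Q \<eta> B by (intro divide_right_mono add_right_mono mult_left_mono) auto
  finally have "\<eta> * sum w P \<le> B / \<eta> * ?G" using B by simp
  then show ?thesis using \<eta> by (simp add: field_simps power2_eq_square)
qed

section \<open>The kernel of a frequency piece\<close>

text \<open>The oscillating factor of the propagator with a Gaussian cutoff:
  \<open>c = 1 / N\<^sup>2\<close> is the regularised case and \<open>c = 0\<close> the
  unregularised one. With \<open>c\<close> a free parameter the product of one wave with the
  conjugate of another is again a wave, the parameters \<open>c\<close> adding up.\<close>

definition wave :: "real \<Rightarrow> real \<Rightarrow> real \<Rightarrow> real \<Rightarrow> real \<Rightarrow> complex" where
  "wave m y t c \<xi> = cis (y * \<xi> + t * \<bar>\<xi>\<bar> powr m) * complex_of_real (exp (- (c * \<xi>\<^sup>2)))"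

definition annulus :: "real \<Rightarrow> real set" where
  "annulus \<Lambda> = {\<xi>. \<Lambda> \<le> \<bar>\<xi>\<bar> \<and> \<bar>\<xi>\<bar> < 2 * \<Lambda>}"

lemma wave_mult_cnj: "wave m y t c \<xi> * cnj (wave m y' t' c' \<xi>) = wave m (y - y') (t - t') (c + c') \<xi>"
proof -
  have "wave m y t c \<xi> * cnj (wave m y' t' c' \<xi>) =
      (cis (y * \<xi> + t * \<bar>\<xi>\<bar> powr m) * cis (- (y' * \<xi> + t' * \<bar>\<xi>\<bar> powr m)))
      * complex_of_real (exp (- (c * \<xi>\<^sup>2)) * exp (- (c' * \<xi>\<^sup>2)))"
    by (simp add: wave_def cis_cnj)
  also have "\<dots> = wave m (y - y') (t - t') (c + c') \<xi>"
    unfolding cis_mult exp_add[symmetric] wave_def by (simp add: algebra_simps)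
  finally show ?thesis .
qed

lemma cmod_wave_le: "c \<ge> 0 \<Longrightarrow> cmod (wave m y t c \<xi>) \<le> 1"
  by (simp add: wave_def norm_mult)

lemma wave_measurable [measurable]: "wave m y t c \<in> borel_measurable borel"
proof -
  have [measurable]: "cis \<in> borel_measurable borel"
    by (intro borel_measurable_continuous_onI continuous_intros)
  show ?thesis unfolding wave_def[abs_def] by measurable
qed

lemma wave_measurable_lebesgue [measurable]: "wave m y t c \<in> borel_measurable lebesgue"
  by (rule measurable_completion) simp

lemma annulus_measurable [measurable]: "annulus \<Lambda> \<in> sets borel"
  unfolding annulus_def by measurable

lemma continuous_on_wave: "m > 0 \<Longrightarrow> continuous_on S (wave m y t c)"
  unfolding wave_def[abs_def] by (intro continuous_intros continuous_on_powr') auto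

lemma wave_uminus: "wave m y t c (- \<xi>) = wave m (- y) t c \<xi>"
  by (simp add: wave_def)

text \<open>The condition \<open>D - L * \<bar>T\<bar> \<le> \<bar>X\<bar>\<close> is what an
  \<open>L\<close>-Lipschitz path gives for starting points at distance \<open>D\<close> and times
  differing by \<open>T\<close>. If \<open>\<bar>T\<bar>\<close> is at least a fixed multiple of
  \<open>D\<close>, the second derivative of the phase is large; otherwise the linear term dominates
  and the first derivative is.\<close>

lemma half_kernel_bound:
  fixes m L :: real
  assumes m: "0 < m" "m < 1" and L: "0 \<le> L"
  shows "\<exists>C\<ge>1. \<forall>\<Lambda> X T b D. 1 \<le> \<Lambda> \<longrightarrow> 0 \<le> b \<longrightarrow> 0 < D \<longrightarrow> D - L * \<bar>T\<bar> \<le> \<bar>X\<bar> \<longrightarrow> 1 \<le> \<Lambda> powr m * D \<longrightarrow>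
      cmod (integral {\<Lambda>..2 * \<Lambda>} (wave m X T b)) \<le> C * \<Lambda> / sqrt (\<Lambda> powr m * D)"
proof -
  \<comment> \<open>The factor \<open>2 powr (m - 2)\<close> accounts for frequencies up to
    \<open>2 * \<Lambda>\<close>, and \<open>1 / (2 * (L + 1))\<close> for the threshold at which
    the two cases are separated.\<close>
  define \<kappa> where "\<kappa> = m * (1 - m) * 2 powr (m - 2) / (2 * (L + 1))"
  have \<kappa>: "\<kappa> > 0" using m L by (simp add: \<kappa>_def)
  have C1: "8 / sqrt \<kappa> + 10 \<ge> 1" using \<kappa> by (simp add: add_increasing)
  have "cmod (integral {\<Lambda>..2 * \<Lambda>} (wave m X T b)) \<le> (8 / sqrt \<kappa> + 10) * \<Lambda> / sqrt (\<Lambda> powr m * D)"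
    if \<Lambda>: "1 \<le> \<Lambda>" and b: "0 \<le> b" and D: "0 < D" and X: "D - L * \<bar>T\<bar> \<le> \<bar>X\<bar>"
      and big: "1 \<le> \<Lambda> powr m * D" for \<Lambda> X T b D :: real
  proof -
    define \<phi> where "\<phi> \<xi> = X * \<xi> + T * \<xi> powr m" for \<xi>
    define \<phi>' where "\<phi>' \<xi> = X + T * (m * \<xi> powr (m - 1))" for \<xi>
    define \<phi>'' where "\<phi>'' \<xi> = T * (m * ((m - 1) * \<xi> powr (m - 2)))" for \<xi>
    define a where "a \<xi> = exp (- (b * \<xi>\<^sup>2))" for \<xi>
    \<comment> \<open>As \<open>m * (m - 1)\<close> is negative, the second derivative of the phase
      has the sign opposite to that of \<open>T\<close>.\<close>
    define \<sigma> where "\<sigma> = (if T > 0 then - 1 else 1 :: real)"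
    have \<sigma>: "\<bar>\<sigma>\<bar> = 1" "\<And>y. \<sigma> * (T * y) = - (\<bar>T\<bar> * y)" by (auto simp: \<sigma>_def)
    have d1: "(\<phi> has_real_derivative \<phi>' \<xi>) (at \<xi>)"
      and d2: "(\<phi>' has_real_derivative \<phi>'' \<xi>) (at \<xi>)"
      and d3: "(a has_real_derivative - (2 * b * \<xi>) * a \<xi>) (at \<xi>)"
      if "\<xi> \<in> {\<Lambda>..2 * \<Lambda>}" for \<xi>
      using that \<Lambda> unfolding \<phi>_def \<phi>'_def \<phi>''_def a_def
      by (auto intro!: derivative_eq_intros simp: has_real_derivative_powr)
    have a01: "0 \<le> a \<xi> \<and> a \<xi> \<le> 1" "- (2 * b * \<xi>) * a \<xi> \<le> 0" if "\<xi> \<in> {\<Lambda>..2 * \<Lambda>}" for \<xi>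
      using that \<Lambda> b by (auto simp: a_def)
    have eq: "integral {\<Lambda>..2 * \<Lambda>} (wave m X T b)
        = integral {\<Lambda>..2 * \<Lambda>} (\<lambda>\<xi>. cis (\<phi> \<xi>) * complex_of_real (a \<xi>))"
      using \<Lambda> by (intro integral_cong) (auto simp: wave_def \<phi>_def a_def)
    have le: "\<Lambda> \<le> 2 * \<Lambda>" using \<Lambda> by simp
    let ?s = "sqrt (\<Lambda> powr m * D)"
    have s: "?s \<ge> 1" using big by simp
    have \<phi>''_pos: "\<sigma> * \<phi>'' \<xi> = \<bar>T\<bar> * (m * (1 - m) * \<xi> powr (m - 2))" for \<xi>
      unfolding \<phi>''_def \<sigma>(2) by (simp add: algebra_simps)
    have C0: "10 * \<Lambda> / ?s \<le> (8 / sqrt \<kappa> + 10) * \<Lambda> / ?s" "8 / sqrt \<kappa> * \<Lambda> / ?s \<le> (8 / sqrt \<kappa> + 10) * \<Lambda> / ?s"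
      using \<kappa> \<Lambda> s by (intro divide_right_mono mult_right_mono; simp)+
    show "cmod (integral {\<Lambda>..2 * \<Lambda>} (wave m X T b)) \<le> (8 / sqrt \<kappa> + 10) * \<Lambda> / ?s"
    proof (cases "D \<le> 2 * (L + 1) * \<bar>T\<bar>")
      case True
      define \<mu> where "\<mu> = \<kappa> * (D * \<Lambda> powr (m - 2))"
      have \<mu>: "\<mu> > 0" using \<kappa> D \<Lambda> by (simp add: \<mu>_def)
      have "\<mu> \<le> \<sigma> * \<phi>'' \<xi>" if \<xi>: "\<xi> \<in> {\<Lambda>..2 * \<Lambda>}" for \<xi>
      proof -
        have "\<mu> = D / (2 * (L + 1)) * (m * (1 - m) * (2 * \<Lambda>) powr (m - 2))"
          using \<Lambda> by (simp add: \<mu>_def \<kappa>_def powr_mult)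
        also have "\<dots> \<le> \<bar>T\<bar> * (m * (1 - m) * (2 * \<Lambda>) powr (m - 2))"
        proof (rule mult_right_mono)
          show "D / (2 * (L + 1)) \<le> \<bar>T\<bar>" using True L by (simp add: field_simps)
        qed (use m in simp)
        also have "\<dots> \<le> \<bar>T\<bar> * (m * (1 - m) * \<xi> powr (m - 2))"
        proof -
          have "(2 * \<Lambda>) powr (m - 2) \<le> \<xi> powr (m - 2)"
            using m \<xi> \<Lambda> by (intro powr_mono2') auto
          then show ?thesis using m by (simp add: mult_left_mono)
        qed
        finally show ?thesis by (simp add: \<phi>''_pos)
      qed
      from van_der_Corput_second[OF le d1 d2 d3 a01 \<sigma>(1) \<mu> this]
      have "cmod (integral {\<Lambda>..2 * \<Lambda>} (wave m X T b)) \<le> 8 / sqrt \<mu>" unfolding eq by blast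
      also have "\<Lambda> powr (m - 2) = \<Lambda> powr m / \<Lambda>\<^sup>2"
        using \<Lambda> by (simp add: powr_diff)
      then have "sqrt \<mu> = sqrt \<kappa> * (?s / \<Lambda>)"
        using \<Lambda> by (simp add: \<mu>_def real_sqrt_mult real_sqrt_divide)
      then have "8 / sqrt \<mu> = 8 / sqrt \<kappa> * \<Lambda> / ?s" by simp
      finally show ?thesis using C0 by linarith
    next
      case False
      \<comment> \<open>Frequencies are at least 1 and \<open>m < 1\<close>, so the dispersive part
        of the derivative is at most \<open>\<bar>T\<bar>\<close>. What remains is at least
        \<open>D - (L + 1) * \<bar>T\<bar>\<close>, which exceeds \<open>D / 2\<close> in this
        case.\<close>
      have "D / 2 \<le> \<bar>\<phi>' \<xi>\<bar>" if \<xi>: "\<xi> \<in> {\<Lambda>..2 * \<Lambda>}" for \<xi>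
      proof -
        have "\<xi> powr (m - 1) \<le> \<xi> powr 0" using \<xi> \<Lambda> m by (intro powr_mono) auto
        then have "m * \<xi> powr (m - 1) \<le> 1 * 1" using m \<xi> \<Lambda> by (intro mult_mono) auto
        then have "\<bar>T * (m * \<xi> powr (m - 1))\<bar> \<le> \<bar>T\<bar>"
          using m by (simp add: abs_mult mult_left_le)
        then have "\<bar>X\<bar> - \<bar>T\<bar> \<le> \<bar>\<phi>' \<xi>\<bar>" unfolding \<phi>'_def by linarith
        with X False show ?thesis by (simp add: algebra_simps)
      qed
      moreover have "0 \<le> \<sigma> * \<phi>'' \<xi>" if "\<xi> \<in> {\<Lambda>..2 * \<Lambda>}" for \<xi>
        unfolding \<phi>''_pos using m by simp
      moreover have "D / 2 > 0" using D by simp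
      ultimately have "cmod (integral {\<Lambda>..2 * \<Lambda>} (wave m X T b)) \<le> 5 / (D / 2)"
        using van_der_Corput_first[OF le d1 d2 d3 a01 \<sigma>(1)] unfolding eq by blast
      also have "\<dots> = 10 / D" by simp
      \<comment> \<open>Because \<open>?s \<ge> 1\<close>, also \<open>?s \<le> ?s\<^sup>2 =
        \<Lambda> powr m * D \<le> \<Lambda> * D\<close>.\<close>
      also have "\<dots> \<le> 10 * \<Lambda> / ?s"
      proof -
        have "?s * 1 \<le> ?s * ?s" using s by (intro mult_left_mono) auto
        then have "?s \<le> \<Lambda> powr m * D" using D \<Lambda> by simp
        also have "\<dots> \<le> \<Lambda> powr 1 * D" using \<Lambda> m D by (intro mult_right_mono powr_mono) auto
        finally have "?s \<le> \<Lambda> * D" using \<Lambda> by simp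
        then show ?thesis using D s \<Lambda> by (simp add: field_simps del: real_sqrt_mult)
      qed
      finally show ?thesis using C0 by linarith
    qed
  qed
  with C1 show ?thesis by blast
qed

lemma wave_set_integrable:
  assumes "c \<ge> 0" "A \<in> lmeasurable"
  shows "set_integrable lebesgue A (wave m y t c)"
  unfolding set_integrable_def
proof (rule Bochner_Integration.integrable_bound)
  show "integrable lebesgue (indicator A :: real \<Rightarrow> real)"
    using assms(2) by (simp add: lmeasurable_iff_integrable)
  show "(\<lambda>x. indicat_real A x *\<^sub>R wave m y t c x) \<in> borel_measurable lebesgue"
    using assms(2) by (intro fmeasurableD borel_measurable_scaleR borel_measurable_indicator wave_measurable_lebesgue)
  show "AE x in lebesgue. norm (indicat_real A x *\<^sub>R wave m y t c x) \<le> norm (indicat_real A x)"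
    using cmod_wave_le[OF assms(1)] by (auto split: split_indicator)
qed

lemma annulus_lmeasurable: "annulus \<Lambda> \<in> lmeasurable"
proof (rule bounded_set_imp_lmeasurable)
  show "bounded (annulus \<Lambda>)"
    by (rule boundedI[of _ "2 * \<Lambda>"]) (auto simp: annulus_def)
qed simp

text \<open>Reflection in the frequency changes only the sign of \<open>X\<close>, since the
  dispersive term and the Gaussian are even; the endpoints form a null set.\<close>

lemma annulus_kernel_split:
  assumes "\<Lambda> \<ge> 1" "b \<ge> 0" "m > 0"
  shows "(LINT \<xi>:annulus \<Lambda>|lebesgue. wave m X T b \<xi>)
    = integral {\<Lambda>..2 * \<Lambda>} (wave m X T b) + integral {\<Lambda>..2 * \<Lambda>} (wave m (- X) T b)"
proof -
  let ?f = "wave m X T b"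
  have "(LINT \<xi>:annulus \<Lambda>|lebesgue. ?f \<xi>) = integral (annulus \<Lambda>) ?f"
    by (intro set_lebesgue_integral_eq_integral(2) wave_set_integrable annulus_lmeasurable assms)
  also have "\<dots> = integral ({\<Lambda>..2 * \<Lambda>} \<union> {- (2 * \<Lambda>)..- \<Lambda>}) ?f"
  proof (rule integral_spike_set)
    show "negligible {\<xi> \<in> annulus \<Lambda> - ({\<Lambda>..2 * \<Lambda>} \<union> {- (2 * \<Lambda>)..- \<Lambda>}). ?f \<xi> \<noteq> 0}"
      using assms by (intro negligible_subset[OF negligible_empty]) (auto simp: annulus_def)
    show "negligible {\<xi> \<in> {\<Lambda>..2 * \<Lambda>} \<union> {- (2 * \<Lambda>)..- \<Lambda>} - annulus \<Lambda>. ?f \<xi> \<noteq> 0}"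
      by (rule negligible_subset[of "{2 * \<Lambda>, - (2 * \<Lambda>)}"])
        (use assms in \<open>auto simp: annulus_def\<close>)
  qed
  also have "\<dots> = integral {\<Lambda>..2 * \<Lambda>} ?f + integral {- (2 * \<Lambda>)..- \<Lambda>} ?f"
    using assms by (intro Henstock_Kurzweil_Integration.integral_Un integrable_continuous_real
        continuous_on_wave) auto
  also have "integral {- (2 * \<Lambda>)..- \<Lambda>} ?f = integral {\<Lambda>..2 * \<Lambda>} (\<lambda>\<xi>. ?f (- \<xi>))"
    using Henstock_Kurzweil_Integration.integral_reflect_real[of "2 * \<Lambda>" \<Lambda> "\<lambda>\<xi>. ?f (- \<xi>)"] by simp
  finally show ?thesis by (simp add: wave_uminus)
qed

text \<open>Below the scale \<open>\<Lambda> powr - m\<close> the length of the interval is the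
  bound; above it the oscillatory estimate applies. Both half-lines are covered, because the
  condition involves \<open>X\<close> only through its modulus.\<close>

lemma kernel_bound:
  fixes m L :: real
  assumes m: "0 < m" "m < 1" and L: "0 \<le> L"
  shows "\<exists>C\<ge>1. \<forall>\<Lambda> X T b D. 1 \<le> \<Lambda> \<longrightarrow> 0 \<le> b \<longrightarrow> D - L * \<bar>T\<bar> \<le> \<bar>X\<bar> \<longrightarrow>
      cmod (LINT \<xi>:annulus \<Lambda>|lebesgue. wave m X T b \<xi>) \<le> C * \<Lambda> * decay (\<Lambda> powr - m) D"
proof -
  obtain C where C1: "C \<ge> 1" and C: "1 \<le> \<Lambda> \<Longrightarrow> 0 \<le> b \<Longrightarrow> 0 < D \<Longrightarrow> D - L * \<bar>T\<bar> \<le> \<bar>X\<bar> \<Longrightarrow> 1 \<le> \<Lambda> powr m * D \<Longrightarrow>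
      cmod (integral {\<Lambda>..2 * \<Lambda>} (wave m X T b)) \<le> C * \<Lambda> / sqrt (\<Lambda> powr m * D)" for \<Lambda> X T b D
    using half_kernel_bound[OF assms] by blast
  show ?thesis
  proof (intro exI[of _ "2 * C"] conjI allI impI)
    show "2 * C \<ge> 1" using C1 by simp
    fix \<Lambda> X T b D :: real
    assume \<Lambda>: "1 \<le> \<Lambda>" and b: "0 \<le> b" and X: "D - L * \<bar>T\<bar> \<le> \<bar>X\<bar>"
    let ?K = "\<lambda>X. cmod (integral {\<Lambda>..2 * \<Lambda>} (wave m X T b))"
    have split: "cmod (LINT \<xi>:annulus \<Lambda>|lebesgue. wave m X T b \<xi>) \<le> ?K X + ?K (- X)"
      unfolding annulus_kernel_split[OF \<Lambda> b m(1)] by (rule norm_triangle_ineq)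
    have "?K Y \<le> C * \<Lambda> * decay (\<Lambda> powr - m) D" if Y: "\<bar>Y\<bar> = \<bar>X\<bar>" for Y
    proof (cases "D < \<Lambda> powr - m")
      case True
      have "?K Y \<le> 1 * (2 * \<Lambda> - \<Lambda>)"
        using \<Lambda> m b by (intro integral_bound continuous_on_wave cmod_wave_le) auto
      also have "\<dots> \<le> C * \<Lambda>" using C1 \<Lambda> by simp
      finally show ?thesis using True by (simp add: decay_def)
    next
      case False
      then have D: "D > 0" using \<Lambda> by (smt (verit) powr_gt_zero)
      have "1 \<le> \<Lambda> powr m * D" using False \<Lambda> by (simp add: powr_minus field_simps)
      from C[OF \<Lambda> b D _ this] X Y have "?K Y \<le> C * \<Lambda> / sqrt (\<Lambda> powr m * D)" by simp
      also have "\<Lambda> powr m * D = 1 / (\<Lambda> powr - m / D)" by (simp add: powr_minus_divide)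
      then have "sqrt (\<Lambda> powr m * D) = 1 / sqrt (\<Lambda> powr - m / D)"
        by (simp only: real_sqrt_divide real_sqrt_one)
      finally show ?thesis using False by (simp add: decay_def)
    qed
    from this[of X] this[of "- X"] split
    show "cmod (LINT \<xi>:annulus \<Lambda>|lebesgue. wave m X T b \<xi>) \<le> 2 * C * \<Lambda> * decay (\<Lambda> powr - m) D"
      by simp
  qed
qed

section \<open>Covering the large values of a frequency piece\<close>

definition piece :: "real \<Rightarrow> (real \<Rightarrow> complex) \<Rightarrow> real \<Rightarrow> real \<Rightarrow> real \<Rightarrow> real \<Rightarrow> complex" where
  "piece m g \<Lambda> y t c = (LINT \<xi>:annulus \<Lambda>|lebesgue. wave m y t c \<xi> * g \<xi>)"

text \<open>Choosing one bad point in each cell of length \<open>\<rho>\<close> and one bad pair of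
  time and cutoff for each point linearises the supremum and leaves a finite problem. The kernel
  bound does not depend on these choices, so duality bounds the total Frostman mass, which in turn
  bounds the cost of the cover.\<close>

lemma large_value_cover:
  fixes m L \<alpha> :: real and path :: "real \<Rightarrow> real"
  assumes m: "0 < m" "m < 1" and L: "0 \<le> L" and \<alpha>: "\<alpha> < 1 / 2"
    and g: "g \<in> borel_measurable lebesgue" "integrable lebesgue (\<lambda>\<xi>. (cmod (g \<xi>))\<^sup>2)"
    and lip: "\<forall>t\<in>{0..1}. \<forall>t'\<in>{0..1}. \<bar>path t - path t'\<bar> \<le> L * \<bar>t - t'\<bar>"
  shows "\<exists>C\<ge>0. \<forall>\<Lambda> \<eta> R. 1 \<le> \<Lambda> \<longrightarrow> 0 < \<eta> \<longrightarrow>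
      (\<exists>\<C>. finite \<C> \<and> (\<forall>U\<in>\<C>. bounded U) \<and>
        {x. \<bar>x\<bar> < R \<and> (\<exists>t\<in>{0..1}. \<exists>c\<ge>0. \<eta> \<le> cmod (piece m g \<Lambda> (x - path t) t c))} \<subseteq> \<Union>\<C> \<and>
        (\<Sum>U\<in>\<C>. diameter U powr \<alpha>)
          \<le> C * \<Lambda> powr (1 - m * \<alpha>) / \<eta>\<^sup>2 * (LINT \<xi>:annulus \<Lambda>|lebesgue. (cmod (g \<xi>))\<^sup>2))"
proof -
  obtain K where K1: "K \<ge> 1" and K: "1 \<le> \<Lambda> \<Longrightarrow> 0 \<le> b \<Longrightarrow> D - L * \<bar>T\<bar> \<le> \<bar>X\<bar> \<Longrightarrow>
      cmod (LINT \<xi>:annulus \<Lambda>|lebesgue. wave m X T b \<xi>) \<le> K * \<Lambda> * decay (\<Lambda> powr - m) D" for \<Lambda> X T b D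
    using kernel_bound[OF m L] by blast
  define S where "S = 5 / (1 - 2 powr (\<alpha> - 1 / 2))"
  have S: "S > 0" using \<alpha> by (simp add: S_def powr_less_one)
  have main: "\<exists>\<C>. finite \<C> \<and> (\<forall>U\<in>\<C>. bounded U) \<and>
        {x. \<bar>x\<bar> < R \<and> (\<exists>t\<in>{0..1}. \<exists>c\<ge>0. \<eta> \<le> cmod (piece m g \<Lambda> (x - path t) t c))} \<subseteq> \<Union>\<C> \<and>
        (\<Sum>U\<in>\<C>. diameter U powr \<alpha>)
          \<le> K * S * \<Lambda> powr (1 - m * \<alpha>) / \<eta>\<^sup>2 * (LINT \<xi>:annulus \<Lambda>|lebesgue. (cmod (g \<xi>))\<^sup>2)"
    if \<Lambda>: "1 \<le> \<Lambda>" and \<eta>: "0 < \<eta>" for \<Lambda> \<eta> R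
  proof -
    define \<rho> where "\<rho> = \<Lambda> powr - m"
    have \<rho>: "\<rho> > 0" using \<Lambda> by (simp add: \<rho>_def)
    define E where "E = {x. \<bar>x\<bar> < R \<and> (\<exists>t\<in>{0..1}. \<exists>c\<ge>0. \<eta> \<le> cmod (piece m g \<Lambda> (x - path t) t c))}"
    have "\<forall>x\<in>E. \<exists>t c. t \<in> {0..1} \<and> c \<ge> 0 \<and> \<eta> \<le> cmod (piece m g \<Lambda> (x - path t) t c)"
      unfolding E_def by blast
    then obtain t c where tc: "t x \<in> {0..1}" "c x \<ge> 0" "\<eta> \<le> cmod (piece m g \<Lambda> (x - path (t x)) (t x) (c x))"
      if "x \<in> E" for x unfolding bchoice_iff by blast
    define I where "I = {i. E \<inter> grid_interval \<rho> i \<noteq> {}}"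
    have "I \<subseteq> {\<lfloor>- R / \<rho>\<rfloor>..\<lfloor>R / \<rho>\<rfloor>}"
      using \<rho> by (auto simp: I_def E_def grid_interval_def abs_less_iff field_simps
          intro!: floor_mono)
    then have fin_I: "finite I" using finite_subset by blast
    have "\<forall>i\<in>I. \<exists>p. p \<in> E \<inter> grid_interval \<rho> i" unfolding I_def by blast
    then obtain pt where pt: "pt i \<in> E \<inter> grid_interval \<rho> i" if "i \<in> I" for i
      unfolding bchoice_iff by blast
    define P where "P = pt ` I"
    have P: "finite P" "P \<subseteq> E" using fin_I pt by (auto simp: P_def)
    \<comment> \<open>The scales must reach \<open>R\<close>, so that the dyadic sum sees all
      distances between points of \<open>P\<close>.\<close>
    obtain n where n: "R < 2 ^ n * \<rho>"
      using real_arch_pow[of 2 "R / \<rho>"] \<rho> by (auto simp: field_simps)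
    have P_bd: "\<bar>p\<bar> < 2 ^ n * \<rho>" if "p \<in> P" for p using that P n by (auto simp: E_def)
    obtain w \<C> where w: "\<And>p. 0 \<le> w p"
      and w_le: "\<And>k i. k \<le> n \<Longrightarrow> sum w (P \<inter> grid_interval (2 ^ k * \<rho>) i) \<le> (2 ^ k * \<rho>) powr \<alpha>"
      and C: "finite \<C>" "\<And>U. U \<in> \<C> \<Longrightarrow> \<exists>k i. U = grid_interval (2 ^ k * \<rho>) i"
        "P \<subseteq> \<Union>\<C>" "(\<Sum>U\<in>\<C>. diameter U powr \<alpha>) \<le> sum w P"
      using frostman_grid[OF P(1) \<rho>, of n \<alpha>] by blast
    \<comment> \<open>A covering cell has scale at least \<open>\<rho>\<close>, so it contains the
      whole \<open>\<rho>\<close>-cell of each sample point in it, and with it every point of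
      \<open>E\<close> that the sample represents.\<close>
    have cover: "E \<subseteq> \<Union>\<C>"
    proof
      fix x assume x: "x \<in> E"
      define i where "i = \<lfloor>x / \<rho>\<rfloor>"
      have xi: "x \<in> grid_interval \<rho> i" by (simp add: grid_interval_def i_def)
      with x have "i \<in> I" by (auto simp: I_def)
      with pt[OF this] C(3) obtain U where U: "U \<in> \<C>" "pt i \<in> U" "pt i \<in> grid_interval \<rho> i"
        by (auto simp: P_def)
      with C(2)[OF U(1)] obtain k j where k: "U = grid_interval (2 ^ k * \<rho>) j" by blast
      have "grid_interval (2 ^ 0 * \<rho>) i \<subseteq> U"
        using grid_interval_laminar[OF \<rho>, of 0 k i j] U unfolding k by auto
      with xi U show "x \<in> \<Union>\<C>" by auto
    qed
    define h where "h x \<xi> = indicat_real (annulus \<Lambda>) \<xi> *\<^sub>R wave m (x - path (t x)) (t x) (c x) \<xi>" for x \<xi>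
    define g' where "g' \<xi> = indicat_real (annulus \<Lambda>) \<xi> *\<^sub>R g \<xi>" for \<xi>
    have ind_meas [measurable]: "indicat_real (annulus \<Lambda>) \<in> borel_measurable lebesgue"
      by (intro borel_measurable_indicator) simp
    have hg: "(\<lambda>\<xi>. h x \<xi> * g' \<xi>) = (\<lambda>\<xi>. indicat_real (annulus \<Lambda>) \<xi> *\<^sub>R (wave m (x - path (t x)) (t x) (c x) \<xi> * g \<xi>))" for x
      by (auto simp: h_def g'_def fun_eq_iff split: split_indicator)
    have hh: "(\<lambda>\<xi>. h x \<xi> * cnj (h y \<xi>)) = (\<lambda>\<xi>. indicat_real (annulus \<Lambda>) \<xi> *\<^sub>R
        wave m ((x - path (t x)) - (y - path (t y))) (t x - t y) (c x + c y) \<xi>)" for x y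
      by (auto simp: h_def wave_mult_cnj fun_eq_iff split: split_indicator)
    have g'2: "(\<lambda>\<xi>. (cmod (g' \<xi>))\<^sup>2) = (\<lambda>\<xi>. indicat_real (annulus \<Lambda>) \<xi> *\<^sub>R (cmod (g \<xi>))\<^sup>2)"
      by (auto simp: g'_def fun_eq_iff split: split_indicator)
    \<comment> \<open>The size \<open>K * \<Lambda>\<close> of the kernel times the bound
      \<open>S * \<rho> powr \<alpha>\<close> on the potential of the weight.\<close>
    define B where "B = K * \<Lambda> * (S * \<rho> powr \<alpha>)"
    have "sum w P \<le> B / \<eta>\<^sup>2 * (LINT \<xi>|lebesgue. (cmod (g' \<xi>))\<^sup>2)"
    proof (rule weighted_large_values[where h = h])
      show "h p \<in> borel_measurable lebesgue" for p unfolding h_def by measurable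
      show "integrable lebesgue (\<lambda>x. h p x * cnj (h q x))" if "p \<in> P" "q \<in> P" for p q
      proof -
        from that P(2) have "p \<in> E" "q \<in> E" by auto
        then have "0 \<le> c p + c q" using tc(2) by (intro add_nonneg_nonneg)
        from wave_set_integrable[OF this annulus_lmeasurable] show ?thesis
          unfolding hh set_integrable_def .
      qed
      show "g' \<in> borel_measurable lebesgue" unfolding g'_def using g(1) by measurable
      show "integrable lebesgue (\<lambda>x. (cmod (g' x))\<^sup>2)"
        unfolding g'2 by (intro integrable_mult_indicator g) simp
      show "\<eta> \<le> cmod (LINT x|lebesgue. h p x * g' x)" if "p \<in> P" for p
        unfolding hg using tc(3)[of p] that P(2) by (auto simp: piece_def set_lebesgue_integral_def)
      show "B > 0" using K1 S \<Lambda> \<rho> by (simp add: B_def)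
      fix p assume p: "p \<in> P"
      have "(\<Sum>q\<in>P. w q * cmod (LINT x|lebesgue. h p x * cnj (h q x)))
          \<le> (\<Sum>q\<in>P. w q * (K * \<Lambda> * decay \<rho> \<bar>p - q\<bar>))"
      proof (intro sum_mono mult_left_mono w)
        fix q assume q: "q \<in> P"
        from p q P(2) have "p \<in> E" "q \<in> E" by auto
        then have pq: "t p \<in> {0..1}" "t q \<in> {0..1}" "0 \<le> c p + c q"
          using tc(1) tc(2) by (blast, blast, intro add_nonneg_nonneg)
        have "\<bar>path (t p) - path (t q)\<bar> \<le> L * \<bar>t p - t q\<bar>" using lip pq(1,2) by blast
        then have "\<bar>p - q\<bar> - L * \<bar>t p - t q\<bar> \<le> \<bar>(p - path (t p)) - (q - path (t q))\<bar>"
          by linarith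
        from K[OF \<Lambda> pq(3) this]
        show "cmod (LINT x|lebesgue. h p x * cnj (h q x)) \<le> K * \<Lambda> * decay \<rho> \<bar>p - q\<bar>"
          unfolding hh \<rho>_def set_lebesgue_integral_def .
      qed
      also have "\<dots> = K * \<Lambda> * (\<Sum>q\<in>P. w q * decay \<rho> \<bar>p - q\<bar>)"
        by (simp add: sum_distrib_left mult_ac)
      also have "\<dots> \<le> B"
        unfolding B_def S_def using K1 \<Lambda>
        by (intro mult_left_mono frostman_potential_bound[OF P(1) w \<rho> \<alpha> w_le P_bd p]) auto
      finally show "(\<Sum>q\<in>P. w q * cmod (LINT x|lebesgue. h p x * cnj (h q x))) \<le> B" .
    qed (use P(1) w \<eta> in auto)
    also have "B = K * S * \<Lambda> powr (1 - m * \<alpha>)"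
    proof -
      have "\<Lambda> * \<rho> powr \<alpha> = \<Lambda> powr (1 - m * \<alpha>)"
        using \<Lambda> powr_add[of \<Lambda> 1 "- (m * \<alpha>)"] by (simp add: \<rho>_def powr_powr)
      then show ?thesis by (simp add: B_def mult_ac)
    qed
    finally have "(\<Sum>U\<in>\<C>. diameter U powr \<alpha>)
        \<le> K * S * \<Lambda> powr (1 - m * \<alpha>) / \<eta>\<^sup>2 * (LINT \<xi>:annulus \<Lambda>|lebesgue. (cmod (g \<xi>))\<^sup>2)"
      using C(4) unfolding g'2 set_lebesgue_integral_def by linarith
    moreover have "\<forall>U\<in>\<C>. bounded U" using C(2) diameter_grid_interval(1) \<rho> by fastforce
    ultimately show ?thesis using C(1) cover unfolding E_def by blast
  qed
  have "K * S \<ge> 0" using K1 S by simp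
  then show ?thesis by (intro exI[of _ "K * S"] conjI allI impI main)
qed

section \<open>Hausdorff null sets\<close>

text \<open>For every \<open>J\<close> the covers of index at least \<open>J\<close> together cover
  \<open>A\<close>, at a cost bounded by a tail of a convergent series. The same tail bounds each
  single term, so the diameters become small as well.\<close>

lemma hausdorff_measure_limsup_eq_0:
  fixes E :: "nat \<Rightarrow> 'a::metric_space set" and \<C> :: "nat \<Rightarrow> 'a set set"
  assumes d: "d > 0" and fin: "\<And>j. finite (\<C> j)" and bdd: "\<And>j U. U \<in> \<C> j \<Longrightarrow> bounded U"
    and cover: "\<And>j. E j \<subseteq> \<Union>(\<C> j)"
    and le: "\<And>j. (\<Sum>U\<in>\<C> j. diameter U powr d) \<le> B j" and B: "summable B"
    and A: "A \<subseteq> {x. \<exists>\<^sub>F j in sequentially. x \<in> E j}"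
  shows "hausdorff_measure d A = 0"
proof -
  have B0: "0 \<le> B j" for j using order_trans[OF sum_nonneg le, of j] by simp
  have dp: "diam_power d U \<le> ennreal (diameter U powr d)" for U :: "'a set"
    using d by (simp add: diam_power_def)
  have "hausdorff_premeasure d \<delta> A \<le> 0 + ennreal \<epsilon>" if \<delta>: "\<delta> > 0" and \<epsilon>: "\<epsilon> > 0" for \<delta> \<epsilon>
  proof -
    \<comment> \<open>One tail has to serve twice: below \<open>\<epsilon>\<close> for the cost,
      below \<open>\<delta> powr d\<close> to force every diameter down to
      \<open>\<delta>\<close>.\<close>
    define \<epsilon>' where "\<epsilon>' = min \<epsilon> (\<delta> powr d)"
    have "\<epsilon>' > 0" using \<delta> \<epsilon> by (simp add: \<epsilon>'_def)
    from suminf_exist_split[OF this B] obtain J where J: "norm (\<Sum>j. B (j + J)) < \<epsilon>'" by auto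
    have sB: "summable (\<lambda>j. B (j + J))" using B by (simp add: summable_iff_shift)
    have "\<exists>f. bij_betw f {..<card (\<C> j)} (\<C> j)" for j
      using ex_bij_betw_nat_finite[OF fin[of j]] by (simp add: atLeast0LessThan)
    then obtain f where f: "bij_betw (f j) {..<card (\<C> j)} (\<C> j)" for j by metis
    \<comment> \<open>Each finite cover is padded with empty sets, which cost 0, to a sequence; the
      double sequence is then enumerated by \<open>prod_decode\<close>.\<close>
    define V where "V j i = (if i < card (\<C> (j + J)) then f (j + J) i else {})" for j i
    have V_in: "V j i = {} \<or> V j i \<in> \<C> (j + J)" for j i
      using bij_betwE[OF f[of "j + J"]] by (auto simp: V_def)
    have V_sum: "(\<Sum>i. diam_power d (V j i)) \<le> ennreal (B (j + J))" for j
    proof -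
      let ?n = "card (\<C> (j + J))"
      have "(\<Sum>i. diam_power d (V j i)) = (\<Sum>i<?n. diam_power d (V j i))"
        by (rule suminf_finite) (auto simp: V_def diam_power_def)
      also have "\<dots> \<le> (\<Sum>i<?n. ennreal (diameter (V j i) powr d))" by (intro sum_mono dp)
      also have "\<dots> = ennreal (\<Sum>i<?n. diameter (f (j + J) i) powr d)" by (simp add: V_def)
      also have "(\<Sum>i<?n. diameter (f (j + J) i) powr d) = (\<Sum>U\<in>\<C> (j + J). diameter U powr d)"
        by (rule sum.reindex_bij_betw[OF f])
      also have "ennreal \<dots> \<le> ennreal (B (j + J))" by (intro ennreal_leI le)
      finally show ?thesis .
    qed
    define W where "W n = (case prod_decode n of (j, i) \<Rightarrow> V j i)" for n
    have W_bdd: "bounded (W n) \<and> diameter (W n) \<le> \<delta>" for n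
    proof -
      obtain j i where "prod_decode n = (j, i)" by (cases "prod_decode n")
      then have W: "W n = V j i" by (simp add: W_def)
      show ?thesis
      proof (cases "W n = {}")
        case True with \<delta> show ?thesis by simp
      next
        case False
        with V_in W have C: "W n \<in> \<C> (j + J)" by metis
        have "diameter (W n) powr d \<le> (\<Sum>U\<in>\<C> (j + J). diameter U powr d)"
          using fin C by (intro member_le_sum) auto
        also have "\<dots> \<le> B (j + J)" by (rule le)
        also have "\<dots> \<le> (\<Sum>j. B (j + J))"
          using sum_le_suminf[OF sB, of "{j}"] B0 by simp
        also have "\<dots> < \<delta> powr d" using J unfolding \<epsilon>'_def real_norm_def by linarith
        finally have "\<not> \<delta> < diameter (W n)" using powr_less_mono2[of d \<delta> "diameter (W n)"] d \<delta> by auto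
        with bdd[OF C] show ?thesis by simp
      qed
    qed
    have W_cover: "A \<subseteq> (\<Union>n. W n)"
    proof
      fix x assume "x \<in> A"
      with A obtain j where j: "j \<ge> J" "x \<in> E j" unfolding frequently_sequentially by blast
      define k where "k = j - J"
      have jk: "j = k + J" using j by (simp add: k_def)
      from j cover obtain U where U: "U \<in> \<C> (k + J)" "x \<in> U" unfolding jk by blast
      then obtain i where "i < card (\<C> (k + J))" "f (k + J) i = U"
        using f[of "k + J"] unfolding bij_betw_def by (metis (no_types, lifting) imageE lessThan_iff)
      then have "W (prod_encode (k, i)) = U" by (simp add: W_def V_def)
      with U show "x \<in> (\<Union>n. W n)" by blast
    qed
    have "hausdorff_premeasure d \<delta> A \<le> (\<Sum>n. diam_power d (W n))"
      unfolding hausdorff_premeasure_def by (rule INF_lower) (use W_bdd W_cover in auto)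
    also have "(\<Sum>n. diam_power d (W n)) = (\<Sum>n. (\<lambda>(j, i). diam_power d (V j i)) (prod_decode n))"
      by (intro suminf_cong) (simp add: W_def split: prod.split)
    also have "\<dots> = (\<Sum>j. \<Sum>i. diam_power d (V j i))"
      by (rule suminf_ennreal_2dimen) simp
    also have "\<dots> \<le> (\<Sum>j. ennreal (B (j + J)))" by (intro suminf_le V_sum) auto
    also have "\<dots> = ennreal (\<Sum>j. B (j + J))" by (rule suminf_ennreal2[OF B0 sB])
    also have "\<dots> \<le> ennreal \<epsilon>"
      using J unfolding \<epsilon>'_def real_norm_def by (intro ennreal_leI) linarith
    finally show ?thesis by simp
  qed
  then have "hausdorff_premeasure d \<delta> A \<le> 0" if "\<delta> > 0" for \<delta>
    by (rule ennreal_le_epsilon) (rule that)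
  then have "hausdorff_measure d A \<le> 0"
    unfolding hausdorff_measure_def by (intro SUP_least) auto
  then show ?thesis by simp
qed

text \<open>Each covering set lies in a closed interval around one of its points with its diameter
  as radius. Diameters are at most 1 at scale 1, so with \<open>d \<le> 1\<close> the length is at
  most twice the diameter to the power \<open>d\<close>.\<close>

lemma hausdorff_measure_0_imp_negligible:
  fixes A :: "real set"
  assumes d: "0 < d" "d \<le> 1" and A: "hausdorff_measure d A = 0"
  shows "negligible A"
  unfolding negligible_outer_le
proof (intro allI impI)
  fix e :: real assume e: "e > 0"
  have "hausdorff_premeasure d 1 A \<le> hausdorff_measure d A"
    unfolding hausdorff_measure_def by (rule SUP_upper) simp
  with A e have "hausdorff_premeasure d 1 A < ennreal (e / 2)" by simp
  then obtain U :: "nat \<Rightarrow> real set" where U: "\<And>i. bounded (U i)" "\<And>i. diameter (U i) \<le> 1" "A \<subseteq> (\<Union>i. U i)"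
    and U_sum: "(\<Sum>i. diam_power d (U i)) < ennreal (e / 2)"
    unfolding hausdorff_premeasure_def INF_less_iff by auto
  define V where "V i = (if U i = {} then {} else cball (SOME a. a \<in> U i) (diameter (U i)))" for i
  have UV: "U i \<subseteq> V i" for i
  proof
    fix x assume x: "x \<in> U i"
    then have "(SOME a. a \<in> U i) \<in> U i" by (rule someI)
    with diameter_bounded_bound[OF U(1) this x] x show "x \<in> V i" by (auto simp: V_def)
  qed
  have V_sets: "V i \<in> sets lborel" for i by (simp add: V_def)
  have V_le: "emeasure lborel (V i) \<le> 2 * diam_power d (U i)" for i
  proof (cases "U i = {}")
    case False
    let ?r = "diameter (U i)"
    have r: "0 \<le> ?r" "?r \<le> 1" using U diameter_ge_0 by auto
    have "?r powr 1 \<le> ?r powr d"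
    proof (cases "?r = 0")
      case False with r d show ?thesis by (intro powr_mono') auto
    qed simp
    then have "?r \<le> ?r powr d" using r by simp
    moreover have "emeasure lborel (V i) = ennreal (2 * ?r)"
      using False r by (simp add: V_def cball_eq_atLeastAtMost)
    ultimately have "emeasure lborel (V i) \<le> ennreal (2 * ?r powr d)"
      by (simp add: ennreal_leI)
    also have "\<dots> = 2 * diam_power d (U i)"
      using False d by (simp add: diam_power_def ennreal_mult)
    finally show ?thesis .
  qed (simp add: V_def)
  define T where "T = (\<Union>i. V i)"
  have T_sets: "T \<in> sets lborel" unfolding T_def using V_sets by blast
  have "emeasure lborel T \<le> (\<Sum>i. emeasure lborel (V i))"
    unfolding T_def using V_sets by (intro emeasure_subadditive_countably) auto
  also have "\<dots> \<le> (\<Sum>i. 2 * diam_power d (U i))" by (intro suminf_le V_le) auto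
  also have "\<dots> = 2 * (\<Sum>i. diam_power d (U i))" by simp
  also have "\<dots> \<le> 2 * ennreal (e / 2)" using U_sum by (intro mult_left_mono) auto
  also have "\<dots> = ennreal e" using e by (simp flip: ennreal_numeral ennreal_mult)
  finally have T_le: "emeasure lebesgue T \<le> ennreal e" using T_sets by simp
  have "A \<subseteq> T" using U(3) UV unfolding T_def by blast
  moreover have "T \<in> lmeasurable"
    using T_sets T_le by (intro fmeasurableI) (auto simp: less_top[symmetric] top_unique)
  moreover have "measure lebesgue T \<le> e"
    using T_le e by (simp add: measure_def enn2real_leI)
  ultimately show "\<exists>T. A \<subseteq> T \<and> T \<in> lmeasurable \<and> measure lebesgue T \<le> e" by blast
qed

text \<open>Exponents just above \<open>d0\<close> determine the bound. The upper end
  \<open>d1\<close> accommodates measure estimates that hold for small exponents only.\<close>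

lemma hausdorff_dim_le:
  fixes A :: "'a::metric_space set"
  assumes "0 \<le> d0" "d0 < d1" "\<And>d. d0 < d \<Longrightarrow> d < d1 \<Longrightarrow> hausdorff_measure d A = 0"
  shows "hausdorff_dim A \<le> ennreal d0"
proof (rule ennreal_le_epsilon)
  fix e :: real assume e: "0 < e"
  define d where "d = d0 + min e ((d1 - d0) / 2)"
  have d: "d0 < d" "d < d1" "d \<le> d0 + e" using e assms(2) by (auto simp: d_def min_def field_simps)
  have "hausdorff_dim A \<le> ennreal d"
    unfolding hausdorff_dim_def using assms d by (intro Inf_lower) force
  also have "\<dots> \<le> ennreal (d0 + e)" using d by (intro ennreal_leI)
  also have "\<dots> = ennreal d0 + ennreal e" using assms e by simp
  finally show "hausdorff_dim A \<le> ennreal d0 + ennreal e" .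
qed

section \<open>Convergence off the exceptional set\<close>

definition low :: "real \<Rightarrow> (real \<Rightarrow> complex) \<Rightarrow> nat \<Rightarrow> real \<Rightarrow> real \<Rightarrow> real \<Rightarrow> complex" where
  "low m g J y t c = (LINT \<xi>:{\<xi>. \<bar>\<xi>\<bar> < 2 ^ J}|lebesgue. wave m y t c \<xi> * g \<xi>)"

text \<open>Used for \<open>c > 0\<close>, where the Gaussian makes the integrand integrable; at
  \<open>c = 0\<close> integrability may fail, and the integral would then take the default value
  0.\<close>

definition full :: "real \<Rightarrow> (real \<Rightarrow> complex) \<Rightarrow> real \<Rightarrow> real \<Rightarrow> real \<Rightarrow> complex" where
  "full m g y t c = (LINT \<xi>|lebesgue. wave m y t c \<xi> * g \<xi>)"

text \<open>Interchange of limits by an \<epsilon>/3 argument. It serves both the removal of the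
  regularisation and the passage to time 0.\<close>

lemma tendsto_uniform_approx:
  fixes h :: "'a \<Rightarrow> 'b::metric_space" and f :: "nat \<Rightarrow> 'a \<Rightarrow> 'b"
  assumes near: "\<And>J. J \<ge> J0 \<Longrightarrow> \<forall>\<^sub>F x in F. dist (h x) (f J x) \<le> e J"
    and lim: "\<And>J. J \<ge> J0 \<Longrightarrow> (f J \<longlongrightarrow> l J) F"
    and L: "\<And>J. J \<ge> J0 \<Longrightarrow> dist L (l J) \<le> e J" and e: "e \<longlonglongrightarrow> 0"
  shows "(h \<longlongrightarrow> L) F"
proof (rule tendstoI)
  fix \<epsilon> :: real assume \<epsilon>: "\<epsilon> > 0"
  have "\<forall>\<^sub>F J in sequentially. e J < \<epsilon> / 3" using e \<epsilon> by (intro order_tendstoD) auto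
  then have "\<forall>\<^sub>F J in sequentially. e J < \<epsilon> / 3 \<and> J \<ge> J0"
    using eventually_ge_at_top by (rule eventually_conj)
  then obtain J where J: "e J < \<epsilon> / 3" "J \<ge> J0" by (auto dest: eventually_happens)
  have "\<forall>\<^sub>F x in F. dist (f J x) (l J) < \<epsilon> / 3" using lim[OF J(2)] \<epsilon> by (intro tendstoD) auto
  with near[OF J(2)] show "\<forall>\<^sub>F x in F. dist (h x) L < \<epsilon>"
  proof eventually_elim
    case (elim x)
    have "dist (h x) L \<le> dist (h x) (f J x) + (dist (f J x) (l J) + dist L (l J))"
      by (metis add_left_mono dist_commute dist_triangle dist_triangle_le order_refl)
    with elim L[OF J(2)] J(1) show ?case by linarith
  qed
qed

context
  fixes m :: real and g :: "real \<Rightarrow> complex"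
  assumes g_meas: "g \<in> borel_measurable lebesgue"
    and g_sq: "integrable lebesgue (\<lambda>\<xi>. (cmod (g \<xi>))\<^sup>2)"
begin

lemma wave_g_measurable: "(\<lambda>\<xi>. wave m y t c \<xi> * g \<xi>) \<in> borel_measurable lebesgue"
  using g_meas by measurable

lemma indicator_scaleR_wave_g_measurable:
  assumes "S \<in> lmeasurable"
  shows "(\<lambda>\<xi>. indicat_real S \<xi> *\<^sub>R (wave m y t c \<xi> * g \<xi>)) \<in> borel_measurable lebesgue"
  using assms wave_g_measurable
  by (intro borel_measurable_scaleR borel_measurable_indicator fmeasurableD)

text \<open>By \<open>cmod (g \<xi>) \<le> 1 + (cmod (g \<xi>))\<^sup>2\<close>, one majorant works
  for all \<open>y\<close>, \<open>t\<close> and \<open>c\<close>, as dominated convergence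
  requires.\<close>

lemma wave_g_dominated:
  assumes "c \<ge> 0"
  shows "norm (indicat_real S \<xi> *\<^sub>R (wave m y t c \<xi> * g \<xi>)) \<le> indicat_real S \<xi> + (cmod (g \<xi>))\<^sup>2"
proof (cases "\<xi> \<in> S")
  case True
  have "norm (wave m y t c \<xi> * g \<xi>) \<le> cmod (g \<xi>)"
    using cmod_wave_le[OF assms, of m y t \<xi>] by (simp add: norm_mult mult_left_le_one_le)
  also have "\<dots> \<le> 1 + (cmod (g \<xi>))\<^sup>2"
    using sum_squares_bound[of 1 "cmod (g \<xi>)"] norm_ge_zero[of "g \<xi>"]
    unfolding power_one mult_1_right by linarith
  finally show ?thesis using True by simp
qed simp

lemma dominant_integrable:
  assumes "S \<in> lmeasurable"
  shows "integrable lebesgue (\<lambda>\<xi>. indicat_real S \<xi> + (cmod (g \<xi>))\<^sup>2)"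
  using assms g_sq by (intro Bochner_Integration.integrable_add) (simp_all add: lmeasurable_iff_integrable)

lemma wave_g_set_integrable:
  assumes "c \<ge> 0" "S \<in> lmeasurable"
  shows "set_integrable lebesgue S (\<lambda>\<xi>. wave m y t c \<xi> * g \<xi>)"
  unfolding set_integrable_def
proof (rule Bochner_Integration.integrable_bound[OF dominant_integrable[OF assms(2)]])
  show "AE \<xi> in lebesgue. norm (indicat_real S \<xi> *\<^sub>R (wave m y t c \<xi> * g \<xi>))
      \<le> norm (indicat_real S \<xi> + (cmod (g \<xi>))\<^sup>2)"
    using wave_g_dominated[OF assms(1)] by (intro AE_I2) (metis abs_ge_self order_trans real_norm_def)
qed (rule indicator_scaleR_wave_g_measurable[OF assms(2)])

lemma gaussian_wave_g_integrable:
  assumes "c > 0"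
  shows "integrable lebesgue (\<lambda>\<xi>. wave m y t c \<xi> * g \<xi>)"
proof (rule Bochner_Integration.integrable_bound)
  \<comment> \<open>Chosen so that the square of the Gaussian cutoff is a multiple of the normal
    density of standard deviation \<open>\<sigma>\<close>.\<close>
  define \<sigma> where "\<sigma> = 1 / (2 * sqrt c)"
  have \<sigma>: "2 * \<sigma>\<^sup>2 * (2 * c) = 1" "\<sigma> > 0" using assms by (auto simp: \<sigma>_def power_divide power_mult_distrib)
  have eq: "exp (- (2 * c * \<xi>\<^sup>2)) = sqrt (2 * pi * \<sigma>\<^sup>2) * normal_density 0 \<sigma> \<xi>" for \<xi>
  proof -
    have "\<xi>\<^sup>2 / (2 * \<sigma>\<^sup>2) = 2 * c * \<xi>\<^sup>2" using \<sigma> by (simp add: field_simps)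
    then show ?thesis using \<sigma>(2) by (simp add: normal_density_def)
  qed
  have "integrable lborel (\<lambda>\<xi>. exp (- (2 * c * \<xi>\<^sup>2)))"
    unfolding eq using \<sigma>(2) by (intro integrable_mult_right integrable_normal_density)
  then have "integrable lebesgue (\<lambda>\<xi>. exp (- (2 * c * \<xi>\<^sup>2)))"
    by (subst integrable_completion) auto
  then show "integrable lebesgue (\<lambda>\<xi>. exp (- (2 * c * \<xi>\<^sup>2)) + (cmod (g \<xi>))\<^sup>2)"
    using g_sq by (rule Bochner_Integration.integrable_add)
  have "norm (wave m y t c \<xi> * g \<xi>) \<le> exp (- (2 * c * \<xi>\<^sup>2)) + (cmod (g \<xi>))\<^sup>2" for \<xi>
  proof -
    have "(exp (- (c * \<xi>\<^sup>2)))\<^sup>2 = exp (- (2 * c * \<xi>\<^sup>2))"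
      by (simp add: power2_eq_square flip: exp_add)
    then show ?thesis
      using sum_squares_bound[of "exp (- (c * \<xi>\<^sup>2))" "cmod (g \<xi>)"]
        mult_nonneg_nonneg[OF exp_ge_zero[of "- (c * \<xi>\<^sup>2)"] norm_ge_zero[of "g \<xi>"]]
      unfolding wave_def norm_mult norm_cis norm_of_real abs_exp_cancel mult_1 by linarith
  qed
  then show "AE \<xi> in lebesgue. norm (wave m y t c \<xi> * g \<xi>) \<le> norm (exp (- (2 * c * \<xi>\<^sup>2)) + (cmod (g \<xi>))\<^sup>2)"
    by (intro AE_I2) (metis abs_ge_self order_trans real_norm_def)
qed (rule wave_g_measurable)

lemma ball_lmeasurable: "{\<xi>::real. \<bar>\<xi>\<bar> < r} \<in> lmeasurable"
proof -
  have "{\<xi>::real. \<bar>\<xi>\<bar> < r} = ball 0 r" by auto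
  then show ?thesis by simp
qed

lemma low_Suc:
  assumes "c \<ge> 0"
  shows "low m g (Suc J) y t c = low m g J y t c + piece m g (2 ^ J) y t c"
proof -
  have un: "{\<xi>::real. \<bar>\<xi>\<bar> < 2 ^ Suc J} = {\<xi>. \<bar>\<xi>\<bar> < 2 ^ J} \<union> annulus (2 ^ J)"
    by (auto simp: annulus_def)
  moreover have "{\<xi>::real. \<bar>\<xi>\<bar> < 2 ^ J} \<inter> annulus (2 ^ J) = {}" by (auto simp: annulus_def)
  ultimately show ?thesis unfolding low_def piece_def un
    by (intro set_integral_Un wave_g_set_integrable assms ball_lmeasurable annulus_lmeasurable)
qed

lemma low_tendsto_full:
  assumes "c > 0"
  shows "(\<lambda>J. low m g J y t c) \<longlonglongrightarrow> full m g y t c"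
  unfolding low_def full_def set_lebesgue_integral_def
proof (rule integral_dominated_convergence)
  show "integrable lebesgue (\<lambda>\<xi>. norm (wave m y t c \<xi> * g \<xi>))"
    by (intro integrable_norm gaussian_wave_g_integrable assms)
  show "AE \<xi> in lebesgue. (\<lambda>J. indicat_real {\<xi>. \<bar>\<xi>\<bar> < 2 ^ J} \<xi> *\<^sub>R (wave m y t c \<xi> * g \<xi>))
      \<longlonglongrightarrow> wave m y t c \<xi> * g \<xi>"
  proof (rule AE_I2)
    fix \<xi> :: real
    obtain K where K: "\<bar>\<xi>\<bar> < 2 ^ K" using real_arch_pow[of 2 "\<bar>\<xi>\<bar>"] by auto
    have "\<bar>\<xi>\<bar> < 2 ^ J" if "J \<ge> K" for J
      using K power_increasing[OF that, of "2::real"] by linarith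
    then have "\<forall>\<^sub>F J in sequentially. indicat_real {\<xi>. \<bar>\<xi>\<bar> < 2 ^ J} \<xi> *\<^sub>R (wave m y t c \<xi> * g \<xi>) = wave m y t c \<xi> * g \<xi>"
      unfolding eventually_sequentially by (intro exI[of _ K]) auto
    then show "(\<lambda>J. indicat_real {\<xi>. \<bar>\<xi>\<bar> < 2 ^ J} \<xi> *\<^sub>R (wave m y t c \<xi> * g \<xi>))
      \<longlonglongrightarrow> wave m y t c \<xi> * g \<xi>" by (rule tendsto_eventually)
  qed
  show "AE \<xi> in lebesgue. norm (indicat_real {\<xi>. \<bar>\<xi>\<bar> < 2 ^ J} \<xi> *\<^sub>R (wave m y t c \<xi> * g \<xi>))
      \<le> norm (wave m y t c \<xi> * g \<xi>)" for J
    by (intro AE_I2) (simp split: split_indicator)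
qed (intro wave_g_measurable indicator_scaleR_wave_g_measurable ball_lmeasurable)+

text \<open>Continuity is joint and includes the boundary \<open>c = 0\<close>, where the
  regularisation has been removed.\<close>

lemma continuous_on_low: "continuous_on {(y, t, c). c \<ge> 0} (\<lambda>(y, t, c). low m g J y t c)"
proof (rule continuous_on_sequentiallyI)
  fix u :: "nat \<Rightarrow> real \<times> real \<times> real" and a
  assume u: "\<forall>n. u n \<in> {(y, t, c). c \<ge> 0}" and "a \<in> {(y, t, c). c \<ge> 0}" and lim: "u \<longlonglongrightarrow> a"
  obtain y t c where a: "a = (y, t, c)" by (cases a)
  let ?y = "\<lambda>n. fst (u n)" and ?t = "\<lambda>n. fst (snd (u n))" and ?c = "\<lambda>n. snd (snd (u n))"
  have un: "u n = (?y n, ?t n, ?c n)" for n by simp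
  have c: "?c n \<ge> 0" for n using u by (metis (mono_tags, lifting) case_prodD mem_Collect_eq un)
  have lims: "?y \<longlonglongrightarrow> y" "?t \<longlonglongrightarrow> t" "?c \<longlonglongrightarrow> c"
    using tendsto_fst[OF lim] tendsto_fst[OF tendsto_snd[OF lim]] tendsto_snd[OF tendsto_snd[OF lim]]
    by (simp_all add: a)
  have "(\<lambda>n. low m g J (?y n) (?t n) (?c n)) \<longlonglongrightarrow> low m g J y t c"
    unfolding low_def set_lebesgue_integral_def
  proof (rule integral_dominated_convergence)
    show "integrable lebesgue (\<lambda>\<xi>. indicat_real {\<xi>. \<bar>\<xi>\<bar> < 2 ^ J} \<xi> + (cmod (g \<xi>))\<^sup>2)"
      by (intro dominant_integrable ball_lmeasurable)
    show "AE \<xi> in lebesgue. (\<lambda>n. indicat_real {\<xi>. \<bar>\<xi>\<bar> < 2 ^ J} \<xi> *\<^sub>R (wave m (?y n) (?t n) (?c n) \<xi> * g \<xi>))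
        \<longlonglongrightarrow> indicat_real {\<xi>. \<bar>\<xi>\<bar> < 2 ^ J} \<xi> *\<^sub>R (wave m y t c \<xi> * g \<xi>)"
      unfolding wave_def by (intro AE_I2 tendsto_intros lims)
    show "AE \<xi> in lebesgue. norm (indicat_real {\<xi>. \<bar>\<xi>\<bar> < 2 ^ J} \<xi> *\<^sub>R (wave m (?y n) (?t n) (?c n) \<xi> * g \<xi>))
        \<le> indicat_real {\<xi>. \<bar>\<xi>\<bar> < 2 ^ J} \<xi> + (cmod (g \<xi>))\<^sup>2" for n
      by (intro AE_I2 wave_g_dominated c)
  qed (intro indicator_scaleR_wave_g_measurable ball_lmeasurable)+
  then show "(\<lambda>n. case u n of (y, t, c) \<Rightarrow> low m g J y t c) \<longlonglongrightarrow> (case a of (y, t, c) \<Rightarrow> low m g J y t c)"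
    by (simp add: a case_prod_unfold)
qed

lemma tendsto_low:
  assumes "(y \<longlongrightarrow> y0) F" "(t \<longlongrightarrow> t0) F" "(c \<longlongrightarrow> c0) F" "\<forall>\<^sub>F x in F. c x \<ge> 0" "c0 \<ge> 0"
  shows "((\<lambda>x. low m g J (y x) (t x) (c x)) \<longlongrightarrow> low m g J y0 t0 c0) F"
  using continuous_on_tendsto_compose[OF continuous_on_low, of "\<lambda>x. (y x, t x, c x)" "(y0, t0, c0)" F J] assms
  by (simp add: tendsto_Pair)

lemma regularized_eq:
  assumes "fourier f = g"
  shows "regularized m f N t x = complex_of_real (1 / (2 * pi)) * full m g x t (1 / N\<^sup>2)"
  by (simp add: regularized_def full_def wave_def assms mult_ac)

text \<open>The low-frequency parts approximate the regularised propagator uniformly in time and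
  cutoff, with error \<open>tail J\<close>. Letting the cutoff tend to 0 identifies
  \<open>v t\<close>, up to the factor \<open>1 / (2 * pi)\<close>, as the value at time
  \<open>t\<close>; letting the time tend to 0 shows that \<open>v\<close> is continuous there from
  the right.\<close>

lemma converges_along_if_pieces_summable:
  fixes \<eta> :: "nat \<Rightarrow> real" and path :: "real \<Rightarrow> real"
  assumes f: "fourier f = g" and \<eta>: "summable \<eta>" "\<And>j. 0 \<le> \<eta> j"
    and path: "(path \<longlongrightarrow> 0) (at_right 0)" "path 0 = 0"
    and pieces: "\<And>j t c. j \<ge> J0 \<Longrightarrow> t \<in> {0..1} \<Longrightarrow> c \<ge> 0 \<Longrightarrow> cmod (piece m g (2 ^ j) (x - path t) t c) \<le> \<eta> j"
  shows "converges_along m f (\<lambda>x t. x - path t) x"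
proof -
  define tail where "tail J = suminf \<eta> - sum \<eta> {..<J}" for J
  have tail: "tail \<longlonglongrightarrow> 0"
    using tendsto_diff[OF tendsto_const summable_LIMSEQ[OF \<eta>(1)], of "suminf \<eta>"] by (simp add: tail_def[abs_def])
  let ?low = "\<lambda>J t c. low m g J (x - path t) t c"
  let ?full = "\<lambda>t c. full m g (x - path t) t c"
  have low_diff: "dist (?low K t c) (?low J t c) \<le> tail J"
    if JK: "J0 \<le> J" "J \<le> K" and t: "t \<in> {0..1}" and c: "c \<ge> 0" for J K t c
  proof -
    have "dist (?low K t c) (?low J t c) \<le> sum \<eta> {..<K} - sum \<eta> {..<J}"
      using JK(2)
    proof (induction K rule: dec_induct)
      case (step K)
      have "dist (?low (Suc K) t c) (?low J t c) \<le> dist (?low (Suc K) t c) (?low K t c) + dist (?low K t c) (?low J t c)"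
        by (rule dist_triangle)
      also have "dist (?low (Suc K) t c) (?low K t c) = cmod (piece m g (2 ^ K) (x - path t) t c)"
        by (simp add: low_Suc[OF c] dist_norm)
      also have "\<dots> \<le> \<eta> K" using pieces[of K t c] JK(1) step.hyps t c by simp
      finally show ?case using step.IH by simp
    qed simp
    also have "\<dots> \<le> tail J" using sum_le_suminf[OF \<eta>(1), of "{..<K}"] \<eta>(2) by (simp add: tail_def)
    finally show ?thesis .
  qed
  have full_diff: "dist (?full t c) (?low J t c) \<le> tail J"
    if J: "J0 \<le> J" and t: "t \<in> {0..1}" and c: "c > 0" for J t c
  proof (rule LIMSEQ_le_const2[OF tendsto_dist[OF low_tendsto_full[OF c] tendsto_const]])
    show "\<exists>N. \<forall>n\<ge>N. dist (?low n t c) (?low J t c) \<le> tail J"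
      using low_diff[OF J _ t] c by (intro exI[of _ J]) auto
  qed
  \<comment> \<open>At cutoff 0 the full integral may diverge, so the candidate value is constructed
    as the limit of a Cauchy sequence of low-frequency parts.\<close>
  have "\<exists>v. \<forall>J\<ge>J0. dist v (?low J t 0) \<le> tail J" if t: "t \<in> {0..1}" for t
  proof -
    have "Cauchy (\<lambda>J. ?low J t 0)"
    proof (rule CauchyI')
      fix e :: real assume "0 < e"
      then have "\<forall>\<^sub>F J in sequentially. tail J < e" using tail by (intro order_tendstoD)
      then obtain M where M: "\<And>J. J \<ge> M \<Longrightarrow> tail J < e" unfolding eventually_sequentially by blast
      show "\<exists>M. \<forall>j\<ge>M. \<forall>n>j. dist (?low j t 0) (?low n t 0) < e"
      proof (intro exI[of _ "max M J0"] allI impI)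
        fix j n assume jn: "max M J0 \<le> j" "j < n"
        have "dist (?low j t 0) (?low n t 0) = dist (?low n t 0) (?low j t 0)"
          by (rule dist_commute)
        also have "\<dots> \<le> tail j" using low_diff[of j n t 0] jn t by simp
        also have "\<dots> < e" using M[of j] jn by simp
        finally show "dist (?low j t 0) (?low n t 0) < e" .
      qed
    qed
    then obtain v where v: "(\<lambda>J. ?low J t 0) \<longlonglongrightarrow> v" by (auto simp: Cauchy_convergent_iff convergent_def)
    have "dist v (?low J t 0) \<le> tail J" if J: "J0 \<le> J" for J
    proof (rule LIMSEQ_le_const2[OF tendsto_dist[OF v tendsto_const]])
      show "\<exists>N. \<forall>n\<ge>N. dist (?low n t 0) (?low J t 0) \<le> tail J"
        using low_diff[OF J _ t] by (intro exI[of _ J]) auto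
    qed
    then show ?thesis by blast
  qed
  then obtain v where v: "dist (v t) (?low J t 0) \<le> tail J" if "t \<in> {0..1}" "J0 \<le> J" for t J
    by metis
  have full_lim: "((\<lambda>N. ?full t (1 / N\<^sup>2)) \<longlongrightarrow> v t) at_top" if t: "t \<in> {0..1}" for t
  proof (rule tendsto_uniform_approx[OF _ _ v[OF t] tail])
    have pos: "\<forall>\<^sub>F N in at_top. 1 / N\<^sup>2 > (0::real)"
      using eventually_gt_at_top[of "0::real"] by eventually_elim simp
    show "\<forall>\<^sub>F N in at_top. dist (?full t (1 / N\<^sup>2)) (?low J t (1 / N\<^sup>2)) \<le> tail J" if "J0 \<le> J" for J
      using pos by eventually_elim (rule full_diff[OF that t])
    have "((\<lambda>N. 1 / N\<^sup>2) \<longlongrightarrow> (0::real)) at_top" by real_asymp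
    then show "((\<lambda>N. ?low J t (1 / N\<^sup>2)) \<longlongrightarrow> ?low J t 0) at_top" for J
      by (intro tendsto_low tendsto_const) auto
  qed
  have reg: "((\<lambda>N. regularized m f N t (x - path t)) \<longlongrightarrow> complex_of_real (1 / (2 * pi)) * v t) at_top"
    if t: "t \<in> {0..1}" for t
    unfolding regularized_eq[OF f] by (intro tendsto_intros full_lim t)
  then have prop_eq: "propagator m f t (x - path t) = complex_of_real (1 / (2 * pi)) * v t" if "t \<in> {0..1}" for t
    unfolding propagator_def using that by (intro tendsto_Lim) auto
  have small: "\<forall>\<^sub>F t in at_right 0. t \<in> {0..1::real}"
    unfolding eventually_at_right_field by (intro exI[of _ 1]) auto
  have v_lim: "(v \<longlongrightarrow> v 0) (at_right 0)"
  proof (rule tendsto_uniform_approx[OF _ _ _ tail])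
    show "\<forall>\<^sub>F t in at_right 0. dist (v t) (?low J t 0) \<le> tail J" if "J0 \<le> J" for J
      using small by eventually_elim (rule v[OF _ that])
    have "((\<lambda>t. ?low J t 0) \<longlongrightarrow> low m g J (x - 0) 0 0) (at_right 0)" for J
      by (intro tendsto_low tendsto_intros path) auto
    then show "((\<lambda>t. ?low J t 0) \<longlongrightarrow> ?low J 0 0) (at_right 0)" for J by (simp add: path)
    show "dist (v 0) (?low J 0 0) \<le> tail J" if "J0 \<le> J" for J using v[OF _ that, of 0] by simp
  qed
  show ?thesis unfolding converges_along_def
  proof (intro conjI)
    show "has_value m f 0 x" using reg[of 0] path by (auto simp: has_value_def)
    show "\<forall>\<^sub>F t in at_right 0. has_value m f t (x - path t)"
      using small by eventually_elim (unfold has_value_def, blast intro: reg)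
    have "((\<lambda>t. complex_of_real (1 / (2 * pi)) * v t) \<longlongrightarrow> complex_of_real (1 / (2 * pi)) * v 0) (at_right 0)"
      by (intro tendsto_intros v_lim)
    moreover have "propagator m f 0 x = complex_of_real (1 / (2 * pi)) * v 0"
      using prop_eq[of 0] path by simp
    moreover have "\<forall>\<^sub>F t in at_right 0. complex_of_real (1 / (2 * pi)) * v t = propagator m f t (x - path t)"
      using small by eventually_elim (simp add: prop_eq)
    ultimately show "((\<lambda>t. propagator m f t (x - path t)) \<longlongrightarrow> propagator m f 0 x) (at_right 0)"
      by (simp add: tendsto_cong)
  qed
qed

end

section \<open>Exceptional sets for a Lipschitz path\<close>

text \<open>A point lying in only finitely many of the sets \<open>E j\<close> has all late pieces
  below \<open>q ^ j\<close>, hence is a point of convergence; the sum over the covers of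
  \<open>E j\<close> decays geometrically, so the limsup set is null.\<close>

lemma hausdorff_measure_divergence_set:
  fixes m s \<alpha> L :: real and path :: "real \<Rightarrow> real"
  assumes m: "0 < m" "m < 1" and s: "0 < s" and \<alpha>: "0 < \<alpha>" "\<alpha> < 1 / 2" "1 - 2 * s < m * \<alpha>"
    and f: "f \<in> sobolev s"
    and lip: "\<forall>t\<in>{0..1}. \<forall>t'\<in>{0..1}. \<bar>path t - path t'\<bar> \<le> L * \<bar>t - t'\<bar>" "0 \<le> L" "path 0 = 0"
  shows "hausdorff_measure \<alpha> (divergence_set m f (\<lambda>x t. x - path t)) = 0"
proof -
  define g where "g = fourier f"
  let ?w = "\<lambda>\<xi>::real. (1 + \<xi>\<^sup>2) powr s"
  have wg: "(\<lambda>\<xi>. complex_of_real ((1 + \<xi>\<^sup>2) powr (s / 2)) * g \<xi>) \<in> borel_measurable lebesgue"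
    "integrable lebesgue (\<lambda>\<xi>. (cmod (complex_of_real ((1 + \<xi>\<^sup>2) powr (s / 2)) * g \<xi>))\<^sup>2)"
    using f by (auto simp: sobolev_def L2_functions_def g_def)
  have pos: "1 + \<xi>\<^sup>2 > 0" for \<xi> :: real by (simp add: add_pos_nonneg)
  have powr_meas: "(\<lambda>\<xi>::real. complex_of_real ((1 + \<xi>\<^sup>2) powr (- s / 2))) \<in> borel_measurable lebesgue"
    by (rule measurable_completion) measurable
  \<comment> \<open>Measurability and square integrability of \<open>g\<close> are read off from the
    weighted function in the Sobolev condition, whose weight is positive and at least 1.\<close>
  have g_meas: "g \<in> borel_measurable lebesgue"
  proof -
    have "complex_of_real ((1 + \<xi>\<^sup>2) powr (- s / 2)) * (complex_of_real ((1 + \<xi>\<^sup>2) powr (s / 2)) * g \<xi>) = g \<xi>" for \<xi>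
      using pos[of \<xi>] by (simp add: powr_minus field_simps)
    with borel_measurable_times[OF powr_meas wg(1)] show ?thesis by (simp only:)
  qed
  have wg_eq: "(cmod (complex_of_real ((1 + \<xi>\<^sup>2) powr (s / 2)) * g \<xi>))\<^sup>2 = ?w \<xi> * (cmod (g \<xi>))\<^sup>2" for \<xi>
    by (simp add: norm_mult power_mult_distrib power2_eq_square flip: powr_add)
  have w_int: "integrable lebesgue (\<lambda>\<xi>. ?w \<xi> * (cmod (g \<xi>))\<^sup>2)" using wg(2) by (simp add: wg_eq)
  have g_sq: "integrable lebesgue (\<lambda>\<xi>. (cmod (g \<xi>))\<^sup>2)"
  proof (rule Bochner_Integration.integrable_bound[OF w_int])
    have "1 \<le> ?w \<xi>" for \<xi> using s by (intro ge_one_powr_ge_zero) auto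
    then have "1 * (cmod (g \<xi>))\<^sup>2 \<le> ?w \<xi> * (cmod (g \<xi>))\<^sup>2" for \<xi> by (intro mult_right_mono) auto
    then show "AE \<xi> in lebesgue. norm ((cmod (g \<xi>))\<^sup>2) \<le> norm (?w \<xi> * (cmod (g \<xi>))\<^sup>2)"
      by (intro AE_I2) simp
  qed (use g_meas in measurable)
  define A where "A = (LINT \<xi>|lebesgue. ?w \<xi> * (cmod (g \<xi>))\<^sup>2)"
  \<comment> \<open>The available decay in 2^j has exponent \<open>- 4 * \<epsilon>\<close>.
    Dividing by the square of the threshold \<open>q ^ j\<close> spends half of it, and the other
    half leaves the summable factor \<open>(q\<^sup>2) ^ j\<close>.\<close>
  define \<epsilon> where "\<epsilon> = (m * \<alpha> + 2 * s - 1) / 4"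
  have \<epsilon>: "\<epsilon> > 0" using \<alpha> by (simp add: \<epsilon>_def)
  define q :: real where "q = 2 powr - \<epsilon>"
  have q: "0 < q" "q < 1" using \<epsilon> by (auto simp: q_def powr_less_one)
  have two_powr: "(2 ^ j :: real) powr a = (2 powr a) ^ j" for j a
    by (simp add: powr_powr mult.commute flip: powr_realpow)
  have annulus_le: "(LINT \<xi>:annulus (2 ^ j)|lebesgue. (cmod (g \<xi>))\<^sup>2) \<le> (2 ^ j) powr (- 2 * s) * A" for j
  proof -
    have "(LINT \<xi>:annulus (2 ^ j)|lebesgue. (cmod (g \<xi>))\<^sup>2)
        \<le> (LINT \<xi>|lebesgue. (2 ^ j) powr (- 2 * s) * (?w \<xi> * (cmod (g \<xi>))\<^sup>2))"
      unfolding set_lebesgue_integral_def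
    proof (intro integral_mono integrable_mult_indicator g_sq integrable_mult_right w_int)
      fix \<xi>
      show "indicat_real (annulus (2 ^ j)) \<xi> *\<^sub>R (cmod (g \<xi>))\<^sup>2 \<le> (2 ^ j) powr (- 2 * s) * (?w \<xi> * (cmod (g \<xi>))\<^sup>2)"
      proof (cases "\<xi> \<in> annulus (2 ^ j)")
        case True
        then have "(2 ^ j)\<^sup>2 \<le> \<bar>\<xi>\<bar>\<^sup>2" unfolding annulus_def by (intro power_mono) auto
        then have "((2 ^ j)\<^sup>2) powr s \<le> ?w \<xi>" using s by (intro powr_mono2) auto
        moreover have "((2 ^ j)\<^sup>2 :: real) powr s = (2 ^ j) powr (2 * s)"
          by (simp add: powr_powr flip: powr_numeral)
        ultimately have "1 \<le> (2 ^ j) powr (- 2 * s) * ?w \<xi>"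
          by (simp add: powr_minus field_simps)
        from mult_right_mono[OF this zero_le_power2[of "cmod (g \<xi>)"]] True show ?thesis
          by (simp add: mult.assoc)
      qed simp
    qed simp
    then show ?thesis by (simp add: A_def)
  qed
  obtain C where C0: "C \<ge> 0" and C: "1 \<le> \<Lambda> \<Longrightarrow> 0 < \<eta> \<Longrightarrow>
      \<exists>\<C>. finite \<C> \<and> (\<forall>U\<in>\<C>. bounded U) \<and>
        {x. \<bar>x\<bar> < R \<and> (\<exists>t\<in>{0..1}. \<exists>c\<ge>0. \<eta> \<le> cmod (piece m g \<Lambda> (x - path t) t c))} \<subseteq> \<Union>\<C> \<and>
        (\<Sum>U\<in>\<C>. diameter U powr \<alpha>)
          \<le> C * \<Lambda> powr (1 - m * \<alpha>) / \<eta>\<^sup>2 * (LINT \<xi>:annulus \<Lambda>|lebesgue. (cmod (g \<xi>))\<^sup>2)" for \<Lambda> \<eta> R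
    using large_value_cover[OF m lip(2) \<alpha>(2) g_meas g_sq lip(1)] by blast
  \<comment> \<open>The restriction \<open>\<bar>x\<bar> < real j\<close> keeps each set bounded, as
    finite covers require, while every fixed \<open>x\<close> satisfies it for large
    \<open>j\<close>.\<close>
  define E where "E j = {x. \<bar>x\<bar> < real j \<and> (\<exists>t\<in>{0..1}. \<exists>c\<ge>0. q ^ j \<le> cmod (piece m g (2 ^ j) (x - path t) t c))}" for j
  have "\<exists>\<C>. finite \<C> \<and> (\<forall>U\<in>\<C>. bounded U) \<and> E j \<subseteq> \<Union>\<C> \<and>
      (\<Sum>U\<in>\<C>. diameter U powr \<alpha>) \<le> C * A * (q\<^sup>2) ^ j" for j
  proof -
    have "C * (2 ^ j) powr (1 - m * \<alpha>) / (q ^ j)\<^sup>2 * (LINT \<xi>:annulus (2 ^ j)|lebesgue. (cmod (g \<xi>))\<^sup>2)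
        \<le> C * (2 ^ j) powr (1 - m * \<alpha>) / (q ^ j)\<^sup>2 * ((2 ^ j) powr (- 2 * s) * A)"
      using C0 by (intro mult_left_mono annulus_le) auto
    also have "\<dots> = C * A * (((2 ^ j) powr (1 - m * \<alpha>) * (2 ^ j) powr (- 2 * s)) / (q ^ j)\<^sup>2)"
      by simp
    also have "(2 ^ j :: real) powr (1 - m * \<alpha>) * (2 ^ j) powr (- 2 * s) = (2 ^ j) powr (- \<epsilon> * 4)"
    proof -
      have "1 - m * \<alpha> + - 2 * s = - \<epsilon> * 4" unfolding \<epsilon>_def by (simp add: field_simps)
      then show ?thesis by (simp only: powr_add[symmetric])
    qed
    also have "\<dots> = (q ^ j) ^ 4"
    proof -
      have "2 powr (- \<epsilon> * 4) = q ^ 4" unfolding q_def powr_powr[symmetric] by simp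
      then show ?thesis unfolding two_powr by (simp only: power_mult[symmetric] mult.commute)
    qed
    also have "(q ^ j) ^ 4 / (q ^ j)\<^sup>2 = (q\<^sup>2) ^ j"
      using q by (simp add: field_simps flip: power_mult power_add)
    finally show ?thesis
      using C[of "2 ^ j" "q ^ j" "real j"] q unfolding E_def by (fastforce intro: order_trans)
  qed
  then obtain \<C> where \<C>: "\<And>j. finite (\<C> j)" "\<And>j U. U \<in> \<C> j \<Longrightarrow> bounded U" "\<And>j. E j \<subseteq> \<Union>(\<C> j)"
      "\<And>j. (\<Sum>U\<in>\<C> j. diameter U powr \<alpha>) \<le> C * A * (q\<^sup>2) ^ j" by metis
  have "q\<^sup>2 < 1" using q by (simp add: power_less_one_iff)
  then have "summable (\<lambda>j. C * A * (q\<^sup>2) ^ j)"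
    by (intro summable_mult summable_geometric) simp
  moreover have "divergence_set m f (\<lambda>x t. x - path t) \<subseteq> {x. \<exists>\<^sub>F j in sequentially. x \<in> E j}"
  proof (rule subsetI, rule ccontr)
    fix x assume x: "x \<in> divergence_set m f (\<lambda>x t. x - path t)" "x \<notin> {x. \<exists>\<^sub>F j in sequentially. x \<in> E j}"
    then have "\<forall>\<^sub>F j in sequentially. x \<notin> E j" by (simp add: not_frequently)
    moreover have "\<forall>\<^sub>F j in sequentially. \<bar>x\<bar> < real j"
      using filterlim_real_sequentially unfolding filterlim_at_top_dense by blast
    ultimately have "\<forall>\<^sub>F j in sequentially. x \<notin> E j \<and> \<bar>x\<bar> < real j" by (rule eventually_conj)
    then obtain J where J: "\<And>j. j \<ge> J \<Longrightarrow> x \<notin> E j \<and> \<bar>x\<bar> < real j" unfolding eventually_sequentially by blast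
    have "converges_along m f (\<lambda>x t. x - path t) x"
    proof (rule converges_along_if_pieces_summable[OF g_meas g_sq, where \<eta> = "\<lambda>j. q ^ j" and ?J0.0 = J])
      show "fourier f = g" by (simp add: g_def)
      show "summable (\<lambda>j. q ^ j)" using q by (intro summable_geometric) simp
      show "cmod (piece m g (2 ^ j) (x - path t) t c) \<le> q ^ j" if "J \<le> j" "t \<in> {0..1}" "0 \<le> c" for j t c
        using J[OF that(1)] that(2,3) unfolding E_def by (metis (mono_tags, lifting) linorder_le_cases mem_Collect_eq)
      show "(path \<longlongrightarrow> 0) (at_right 0)"
      proof (rule Lim_null_comparison)
        have "\<forall>\<^sub>F t in at_right 0. t \<in> {0..1::real}"
          unfolding eventually_at_right_field by (intro exI[of _ 1]) auto
        then show "\<forall>\<^sub>F t in at_right 0. norm (path t) \<le> L * t"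
        proof eventually_elim
          case (elim t)
          with lip(1)[rule_format, of t 0] lip(3) show ?case by simp
        qed
        have "((\<lambda>t. L * t) \<longlongrightarrow> L * 0) (at_right 0)" by (intro tendsto_intros)
        then show "((\<lambda>t. L * t) \<longlongrightarrow> 0) (at_right 0)" by simp
      qed
    qed (use q lip in auto)
    with x show False by (simp add: divergence_set_def)
  qed
  ultimately show ?thesis
    by (intro hausdorff_measure_limsup_eq_0[where \<C> = \<C> and E = E and B = "\<lambda>j. C * A * (q\<^sup>2) ^ j"] \<alpha>(1) \<C>)
qed

section \<open>The power curve and the final assembly\<close>

text \<open>Mean value theorem, with differentiability in the open interval only, which admits the
  endpoint 0. As \<open>\<kappa> \<ge> 1\<close>, the derivative is at most \<open>\<kappa>\<close>
  on the unit interval.\<close>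

lemma powr_lipschitz_unit_interval:
  fixes \<kappa> :: real
  assumes "\<kappa> \<ge> 1" "t \<in> {0..1}" "t' \<in> {0..1}"
  shows "\<bar>t powr \<kappa> - t' powr \<kappa>\<bar> \<le> \<kappa> * \<bar>t - t'\<bar>"
proof -
  have *: "b powr \<kappa> - a powr \<kappa> \<le> \<kappa> * (b - a)" if ab: "0 \<le> a" "a < b" "b \<le> 1" for a b
  proof -
    have "\<exists>l z. a < z \<and> z < b \<and> DERIV (\<lambda>t. t powr \<kappa>) z :> l \<and> b powr \<kappa> - a powr \<kappa> = (b - a) * l"
    proof (rule MVT[OF ab(2)])
      show "continuous_on {a..b} (\<lambda>t. t powr \<kappa>)"
        using ab assms(1) by (intro continuous_on_powr' continuous_intros) auto
      show "(\<lambda>t. t powr \<kappa>) differentiable (at z)" if "a < z" "z < b" for z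
        using has_real_derivative_powr[of z \<kappa>] that ab(1) real_differentiable_def by auto
    qed
    then obtain l z where z: "a < z" "z < b" "DERIV (\<lambda>t. t powr \<kappa>) z :> l"
      and eq: "b powr \<kappa> - a powr \<kappa> = (b - a) * l" by blast
    have "l = \<kappa> * z powr (\<kappa> - 1)"
      using z ab by (intro DERIV_unique[OF z(3)] has_real_derivative_powr) auto
    also have "z powr (\<kappa> - 1) \<le> 1 powr (\<kappa> - 1)" using z ab assms(1) by (intro powr_mono2) auto
    finally have "l \<le> \<kappa>" using assms(1) by (simp add: mult_left_le)
    then have "(b - a) * l \<le> (b - a) * \<kappa>" using ab by (intro mult_left_mono) auto
    then show ?thesis using eq by (simp add: mult.commute)
  qed
  have mono: "a powr \<kappa> \<le> b powr \<kappa>" if "0 \<le> a" "a \<le> b" for a b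
    using that assms(1) by (intro powr_mono2) auto
  consider "t < t'" | "t = t'" | "t' < t" by linarith
  then show ?thesis
  proof cases
    case 1 with *[of t t'] mono[of t t'] assms show ?thesis by simp
  next
    case 3 with *[of t' t] mono[of t' t] assms show ?thesis by simp
  qed simp
qed

lemma hausdorff_measure_divergence_set_powr:
  fixes m \<kappa> \<theta> s \<alpha> :: real
  assumes "0 < m" "m < 1" "\<kappa> \<ge> 1" "\<theta> > 0" "0 < s" "0 < \<alpha>" "\<alpha> < 1 / 2" "1 - 2 * s < m * \<alpha>" "f \<in> sobolev s"
  shows "hausdorff_measure \<alpha> (divergence_set m f (\<lambda>x t. x - \<theta> * t powr \<kappa>)) = 0"
proof (rule hausdorff_measure_divergence_set[where L = "\<theta> * \<kappa>"])
  show "\<forall>t\<in>{0..1}. \<forall>t'\<in>{0..1}. \<bar>\<theta> * t powr \<kappa> - \<theta> * t' powr \<kappa>\<bar> \<le> \<theta> * \<kappa> * \<bar>t - t'\<bar>"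
  proof (intro ballI)
    fix t t' :: real assume "t \<in> {0..1}" "t' \<in> {0..1}"
    from powr_lipschitz_unit_interval[OF assms(3) this] assms(4)
    show "\<bar>\<theta> * t powr \<kappa> - \<theta> * t' powr \<kappa>\<bar> \<le> \<theta> * \<kappa> * \<bar>t - t'\<bar>"
      by (simp add: abs_mult mult.assoc mult_left_mono flip: right_diff_distrib)
  qed
qed (use assms in auto)

text \<open>The quotient of the two weights is bounded by 1. This allows a large \<open>s\<close> to
  be lowered below 1/2.\<close>

lemma sobolev_mono:
  assumes "s' \<le> s" "f \<in> sobolev s"
  shows "f \<in> sobolev s'"
proof -
  define h where "h \<xi> = complex_of_real ((1 + \<xi>\<^sup>2) powr (s / 2)) * fourier f \<xi>" for \<xi>
  define r where "r \<xi> = complex_of_real ((1 + \<xi>\<^sup>2) powr ((s' - s) / 2))" for \<xi>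
  have f: "f \<in> L2_functions" and h: "h \<in> borel_measurable lebesgue" "integrable lebesgue (\<lambda>\<xi>. (cmod (h \<xi>))\<^sup>2)"
    using assms(2) by (auto simp: sobolev_def L2_functions_def h_def[abs_def])
  have eq: "complex_of_real ((1 + \<xi>\<^sup>2) powr (s' / 2)) * fourier f \<xi> = r \<xi> * h \<xi>" for \<xi>
  proof -
    have "s' / 2 = (s' - s) / 2 + s / 2" by (simp add: field_simps)
    then have "(1 + \<xi>\<^sup>2) powr (s' / 2) = (1 + \<xi>\<^sup>2) powr ((s' - s) / 2) * (1 + \<xi>\<^sup>2) powr (s / 2)"
      by (metis powr_add)
    then show ?thesis by (simp add: r_def h_def mult.assoc)
  qed
  have r_meas: "r \<in> borel_measurable lebesgue"
    unfolding r_def by (rule measurable_completion) measurable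
  then have rh: "(\<lambda>\<xi>. r \<xi> * h \<xi>) \<in> borel_measurable lebesgue" using h(1) by (rule borel_measurable_times)
  have "cmod (r \<xi>) \<le> 1" for \<xi>
  proof -
    have "(1 + \<xi>\<^sup>2) powr ((s' - s) / 2) \<le> (1 + \<xi>\<^sup>2) powr 0"
      using assms(1) by (intro powr_mono) auto
    moreover have "1 + \<xi>\<^sup>2 > 0" by (simp add: add_pos_nonneg)
    ultimately show ?thesis by (simp add: r_def)
  qed
  then have "cmod (r \<xi> * h \<xi>) \<le> cmod (h \<xi>)" for \<xi>
    by (simp add: norm_mult mult_left_le_one_le)
  then have "integrable lebesgue (\<lambda>\<xi>. (cmod (r \<xi> * h \<xi>))\<^sup>2)"
    by (intro Bochner_Integration.integrable_bound[OF h(2)] AE_I2)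
      (use rh in \<open>auto intro!: power_mono\<close>)
  with f rh show ?thesis by (simp add: sobolev_def L2_functions_def eq)
qed

theorem theorem2:
  fixes m \<kappa> \<theta> :: real and \<gamma> :: "real \<Rightarrow> real \<Rightarrow> real"
  assumes "0 < m" and "m < 1"
    and "\<kappa> \<ge> 1"
    and "\<theta> > 0"
    and "\<gamma> = (\<lambda>x t. x - \<theta> * t powr \<kappa>)"
  shows "(\<forall>s > 1/2 - m/4. \<forall>f \<in> sobolev s. AE x in lebesgue. converges_along m f \<gamma> x) \<and>
         (\<forall>s. 1/2 - m/4 < s \<and> s < 1/2 \<longrightarrow>
            (\<forall>f \<in> sobolev s. hausdorff_dim (divergence_set m f \<gamma>) \<le> ennreal ((1 - 2 * s) / m)))"
proof -
  have null: "hausdorff_measure \<alpha> (divergence_set m f \<gamma>) = 0"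
    if s: "1/2 - m/4 < s" "s < 1/2" and f: "f \<in> sobolev s" and \<alpha>: "(1 - 2 * s) / m < \<alpha>" "\<alpha> < 1/2" for s f \<alpha>
  proof -
    have "0 < (1 - 2 * s) / m" using s assms(1) by simp
    with \<alpha>(1) have "0 < \<alpha>" by linarith
    moreover have "1 - 2 * s < m * \<alpha>" using \<alpha>(1) assms(1) by (simp add: field_simps)
    moreover have "0 < s" using s(1) assms(2) by simp
    ultimately show ?thesis unfolding assms(5)
      using assms \<alpha>(2) f by (intro hausdorff_measure_divergence_set_powr[where s = s]) auto
  qed
  \<comment> \<open>The threshold \<open>1/2 - m/4\<close> for \<open>s\<close> is exactly what
    leaves room for an exponent between \<open>(1 - 2 * s) / m\<close> and 1/2, the limit of the
    Frostman argument.\<close>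
  have dim: "(1 - 2 * s) / m < 1/2" "0 \<le> (1 - 2 * s) / m" if "1/2 - m/4 < s" "s < 1/2" for s
    using that assms(1) by (auto simp: field_simps)
  have "AE x in lebesgue. converges_along m f \<gamma> x" if s: "1/2 - m/4 < s" and f: "f \<in> sobolev s" for s f
  proof -
    \<comment> \<open>The value \<open>1/2 - m/8\<close> is the midpoint of the admissible interval
      from \<open>1/2 - m/4\<close> to 1/2.\<close>
    define s' where "s' = min s (1/2 - m/8)"
    have s': "1/2 - m/4 < s'" "s' < 1/2" "s' \<le> s" using s assms(1) unfolding s'_def by linarith+
    from dense[OF dim(1)[OF s'(1,2)]] obtain \<alpha> where \<alpha>: "(1 - 2 * s') / m < \<alpha>" "\<alpha> < 1/2" by blast
    have "0 < \<alpha>" using \<alpha>(1) dim(2)[OF s'(1,2)] by linarith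
    with \<alpha>(2) null[OF s'(1,2) sobolev_mono[OF s'(3) f] \<alpha>] have "negligible (divergence_set m f \<gamma>)"
      by (intro hausdorff_measure_0_imp_negligible[of \<alpha>]) auto
    then show ?thesis
      by (intro AE_I'[of "divergence_set m f \<gamma>"]) (auto simp: negligible_iff_null_sets divergence_set_def)
  qed
  moreover have "hausdorff_dim (divergence_set m f \<gamma>) \<le> ennreal ((1 - 2 * s) / m)"
    if "1/2 - m/4 < s" "s < 1/2" "f \<in> sobolev s" for s f
    using dim[OF that(1,2)] null[OF that] by (intro hausdorff_dim_le)
  ultimately show ?thesis by blast
qed

end
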